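(* Let $\mathbb{F}$ be an algebraically closed field, and let $m,r\ge1$, $1\le p\le N-2$ be integers. Let $\sigma_0,\ldots,\sigma_{N-1}\in\mathbb{F}$, let $\xi_1,\ldots,\xi_N\in(\mathbb{F}\cup\{\infty\})\setminus\{0\}$, and let $\beta_0,\ldots,\beta_N\in\mathbb{F}$ be nonzero. Put $$g_i=\beta_i(1-\lambda/\xi_i),\quad h_j=\lambda-\sigma_j,\quad b_0(\lambda)=\frac1{\beta_0},\quad b_i(\lambda)=\frac1{\beta_0}\prod_{k=1}^{i}\frac{h_{k-1}}{g_k},$$ for $i=1,\ldots,N$ and $j=0,\ldots,N-1$. Let $\widetilde D_0,\ldots,\widetilde D_p\in\mathbb{F}^{m\times m}$, $\widetilde L_{p+1},\ldots,\widetilde L_N\in\mathbb{F}^{m\times r}$, $\widetilde U\in\mathbb{F}^{m\times r}$, and let $\widetilde Q_N(\lambda)=\sum_{i=0}^{p}b_i(\lambda)\widetilde D_i+\sum_{i=p+1}^{N}b_i(\lambda)\widetilde L_i\widetilde U^T$ and $\widetilde L_N(\lambda)=\begin{bmatrix} \widetilde M_N(\lambda) \\ \widetilde K_N(\lambda) \end{bmatrix}$, where $$\widetilde M_N(\lambda)=\begin{bmatrix}\frac{g_N}{\beta_N}\widetilde D_0&\cdots&\frac{g_N}{\beta_N}\widetilde D_p&\frac{g_N}{\beta_N}\widetilde L_{p+1}&\cdots&\frac{g_N}{\beta_N}\widetilde L_{N-2}&\frac{g_N}{\beta_N}\widetilde L_{N-1}+\frac{h_{N-1}}{\beta_N}\widetilde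 L_N\end{bmatrix},$$ $$\widetilde K_N(\lambda)=\begin{bmatrix}-h_0I_m&g_1I_m \\ &\ddots&\ddots \\ &&-h_{p-1}I_m&g_pI_m \\ &&&-h_p\widetilde U^T&g_{p+1}I_r \\ &&&&-h_{p+1}I_r&g_{p+2}I_r \\ &&&&&\ddots&\ddots \\ &&&&&&-h_{N-2}I_r&g_{N-1}I_r\end{bmatrix}.$$ Let $\widetilde A_N(\lambda)$ be the square submatrix obtained from $\widetilde K_N(\lambda)$ by removing its first block column (its first $m$ columns). Define $$\widetilde R_N^{(1)}(\lambda)=\frac{g_N}{h_{N-1}}\left[\sum_{j=1}^{p-1}\left(\prod_{k=j+1}^{p}\frac{g_k}{h_{k-1}}\right)\widetilde D_j+\widetilde D_p\right],\qquad\widetilde R_N^{(2)}(\lambda)=\sum_{j=p+1}^{N-1}\left(\prod_{k=j+1}^{N}\frac{g_k}{h_{k-1}}\right)\widetilde L_j+\widetilde L_N,$$ $$\widetilde R_N(\lambda)=\begin{bmatrix} \widetilde R_N^{(1)}(\lambda) & \widetilde R_N^{(2)}(\lambda) \\ \left(\prod_{i=1}^{p-1}\frac{g_i}{h_i}\right)g_p\,I_m & 0 \\ -h_p\,\widetilde U^T & \left(\prod_{i=p+1}^{N-2}\frac{g_i}{h_i}\right)g_{N-1}\,I_r \end{bmatrix}.$$ Let $\mathcal{P}_{N-1}$ be the set of finite poles in the list $(\xi_1,\ldots,\xi_{N-1})$. If $\operatorname{rank}\widetilde U=r$, $\xi_i\ne\sigma_j$ for $1\le i\le N$, $0\le j\le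 N-1$, and $\widetilde R_N(\xi_k)\in\mathbb{F}^{(2m+r)\times(m+r)}$ has full column rank for every $\xi_k\in\mathcal{P}_{N-1}$, then $\widetilde L_N(\lambda)$ is a linearization of $\widetilde Q_N(\lambda)$ with state matrix $\widetilde A_N(\lambda)$ in $\mathbb{F}$, if $\xi_N=\infty$, or in $\mathbb{F}\setminus\{\xi_N\}$, if $\xi_N$ is finite.
   Context: Conventions: $\lambda/\xi_i:=0$ if $\xi_i=\infty$; empty products equal $1$ and empty sums equal $0$; the $\xi_i$ are called poles and $\mathcal{P}_{N-1}=\{\xi_i:1\le i\le N-1,\ \xi_i\neq\infty\}$. (The pencil $\widetilde L_N(\lambda)$ should not be confused with the constant matrix $\widetilde L_N$.) A polynomial matrix partitioned as $P(\lambda)=\begin{bmatrix} D(\lambda) & -C(\lambda) \\ B(\lambda) & A(\lambda) \end{bmatrix}$, with $A(\lambda)$ of size $n\times n$ and $\det A(\lambda)\not\equiv0$, is called a polynomial system matrix with state matrix $A(\lambda)$; its transfer function matrix is the Schur complement $D(\lambda)+C(\lambda)A(\lambda)^{-1}B(\lambda)$; it is linear if it has degree at most $1$. It is minimal at $\lambda_0\in\mathbb{F}$ if $\operatorname{rank}\begin{bmatrix} A(\lambda_0) \\ C(\lambda_0) \end{bmatrix}=\operatorname{rank}\begin{bmatrix} A(\lambda_0) & B(\lambda_0) \end{bmatrix}=n$. For $\widetilde L_N(\lambda)$ with state matrix $\widetilde A_N(\lambda)$, the block $D(\lambda)$ is the first $m$ columns of $\widetilde M_N$, $-C(\lambda)$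 the remaining columns of $\widetilde M_N$, and $B(\lambda)$ the first $m$ columns of $\widetilde K_N$. A square rational matrix is regular at $\lambda_0\in\mathbb{F}$ if no entry has a pole at $\lambda_0$ and its determinant is nonzero at $\lambda_0$. A linear polynomial system matrix $\mathcal{L}(\lambda)\in\mathbb{F}[\lambda]^{(n+q)\times(n+t)}$ with state matrix $A(\lambda)\in\mathbb{F}[\lambda]^{n\times n}$ and transfer function matrix $\widehat G(\lambda)\in\mathbb{F}(\lambda)^{q\times t}$ is a linearization of $G(\lambda)\in\mathbb{F}(\lambda)^{m\times m}$ with state matrix $A(\lambda)$ in a nonempty set $\Sigma\subseteq\mathbb{F}$ if for each $\lambda_0\in\Sigma$: $\mathcal{L}$ is minimal at $\lambda_0$, and there exist integers $s_1,s_2\ge0$ with $s_1-s_2=q-m=t-m$ and rational matrices $R_1,R_2$ regular at $\lambda_0$, both of size $m+s_1$, such that $R_1\,\mathrm{diag}(G,I_{s_1})\,R_2=\mathrm{diag}(\widehat G,I_{s_2})$. *)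

theory Defs
  imports
    "Jordan_Normal_Form.DL_Rank"
    "Jordan_Normal_Form.Gauss_Jordan_Elimination"
    "HOL-Computational_Algebra.Polynomial_Factorial"
begin

section \<open>Rational functions and matrices over them\<close>

type_synonym 'a ratfun = "'a poly fract"

definition const_ratfun :: "'a::field \<Rightarrow> 'a ratfun" where
  "const_ratfun c = to_fract [:c:]"

definition ratfun_defined_at :: "'a::field ratfun \<Rightarrow> 'a \<Rightarrow> bool" where
  "ratfun_defined_at f x \<longleftrightarrow> (\<exists>u v. poly v x \<noteq> 0 \<and> f = Fraction_Field.Fract u v)"

text \<open>The value at \<open>x\<close>; it is meaningful only if \<open>f\<close> has no pole at \<open>x\<close>.\<close>

definition ratfun_eval :: "'a::field ratfun \<Rightarrow> 'a \<Rightarrow> 'a" where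
  "ratfun_eval f x =
     (THE y. \<exists>u v. poly v x \<noteq> 0 \<and> f = Fraction_Field.Fract u v \<and> y = poly u x / poly v x)"

lemma ratfun_eval_Fract:
  fixes u v :: "'a::field poly"
  assumes "poly v x \<noteq> 0"
  shows "ratfun_eval (Fraction_Field.Fract u v) x = poly u x / poly v x"
  unfolding ratfun_eval_def
proof (rule the_equality)
  show "\<exists>u' v'. poly v' x \<noteq> 0 \<and> Fraction_Field.Fract u v = Fraction_Field.Fract u' v' \<and>
          poly u x / poly v x = poly u' x / poly v' x"
    using assms by blast
next
  fix y
  assume "\<exists>u' v'. poly v' x \<noteq> 0 \<and> Fraction_Field.Fract u v = Fraction_Field.Fract u' v' \<and>
            y = poly u' x / poly v' x"
  then obtain u' v' where v': "poly v' x \<noteq> 0"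
    and eq: "Fraction_Field.Fract u v = Fraction_Field.Fract u' v'"
    and y: "y = poly u' x / poly v' x" by blast
  have "v \<noteq> 0" "v' \<noteq> 0" using assms v' by auto
  with eq have "u * v' = u' * v" by (simp add: eq_fract)
  then have "poly u x * poly v' x = poly u' x * poly v x" by (metis poly_mult)
  then show "y = poly u x / poly v x"
    using y assms v' by (simp add: frac_eq_eq)
qed

definition poly_mat_eval :: "'a::field poly mat \<Rightarrow> 'a \<Rightarrow> 'a mat" where
  "poly_mat_eval P x = map_mat (\<lambda>f. poly f x) P"

definition ratfun_mat_eval :: "'a::field ratfun mat \<Rightarrow> 'a \<Rightarrow> 'a mat" where
  "ratfun_mat_eval R x = map_mat (\<lambda>f. ratfun_eval f x) R"

definition regular_at :: "'a::field ratfun mat \<Rightarrow> 'a \<Rightarrow> bool" where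
  "regular_at R x \<longleftrightarrow> square_mat R \<and>
     (\<forall>i<dim_row R. \<forall>j<dim_col R. ratfun_defined_at (R $$ (i,j)) x) \<and>
     ratfun_eval (det R) x \<noteq> 0"

definition mat_rank :: "'a::field mat \<Rightarrow> nat" where
  "mat_rank A = vec_space.rank (dim_row A) A"


section \<open>Block matrices\<close>

definition append_cols :: "'a::zero mat \<Rightarrow> 'a mat \<Rightarrow> 'a mat" (infixr \<open>@\<^sub>c\<close> 65) where
  "A @\<^sub>c B = four_block_mat A B (0\<^sub>m 0 (dim_col A)) (0\<^sub>m 0 (dim_col B))"

text \<open>Concatenations of a list of blocks; the first argument is the common number of rows
  (respectively columns) of the blocks.\<close>

definition hconcat :: "nat \<Rightarrow> 'a::zero mat list \<Rightarrow> 'a mat" where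
  "hconcat nr Bs = foldr append_cols Bs (0\<^sub>m nr 0)"

definition vconcat :: "nat \<Rightarrow> 'a::zero mat list \<Rightarrow> 'a mat" where
  "vconcat nc Bs = foldr append_rows Bs (0\<^sub>m 0 nc)"

definition diag_id :: "'a::{zero,one} mat \<Rightarrow> nat \<Rightarrow> 'a mat" where
  "diag_id G s = four_block_mat G (0\<^sub>m (dim_row G) s) (0\<^sub>m s (dim_col G)) (1\<^sub>m s)"


section \<open>System matrices and linearizations\<close>

definition system_matrix ::
  "nat \<Rightarrow> nat \<Rightarrow> nat \<Rightarrow> 'a::field poly mat \<Rightarrow> 'a poly mat \<Rightarrow> 'a poly mat \<Rightarrow> 'a poly mat \<Rightarrow> 'a poly mat \<Rightarrow> bool"
where
  "system_matrix n q t P D C B A \<longleftrightarrow>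
     D \<in> carrier_mat q t \<and> C \<in> carrier_mat q n \<and> B \<in> carrier_mat n t \<and> A \<in> carrier_mat n n \<and>
     det A \<noteq> 0 \<and> P = four_block_mat D (- C) B A"

text \<open>The library function \<^const>\<open>mat_inverse\<close> returns \<open>Some\<close> of the inverse exactly for
  invertible matrices, so \<^const>\<open>the\<close> is harmless whenever \<open>det A \<noteq> 0\<close>.\<close>

definition transfer_function ::
  "'a::field poly mat \<Rightarrow> 'a poly mat \<Rightarrow> 'a poly mat \<Rightarrow> 'a poly mat \<Rightarrow> 'a ratfun mat" where
  "transfer_function D C B A =
     map_mat to_fract D +
     map_mat to_fract C * the (mat_inverse (map_mat to_fract A)) * map_mat to_fract B"

definition minimal_at ::
  "'a::field poly mat \<Rightarrow> 'a poly mat \<Rightarrow> 'a poly mat \<Rightarrow> 'a \<Rightarrow> bool" where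
  "minimal_at C B A x \<longleftrightarrow>
     mat_rank (poly_mat_eval A x @\<^sub>r poly_mat_eval C x) = dim_row A \<and>
     mat_rank (poly_mat_eval A x @\<^sub>c poly_mat_eval B x) = dim_row A"

definition linear_poly_mat :: "'a::field poly mat \<Rightarrow> bool" where
  "linear_poly_mat P \<longleftrightarrow> (\<forall>i<dim_row P. \<forall>j<dim_col P. degree (P $$ (i,j)) \<le> 1)"

text \<open>\<open>P\<close> is a linearization of \<open>G\<close> with state matrix \<open>A\<close> in \<open>\<Sigma>\<close>. The blocks \<open>D\<close>, \<open>C\<close>, \<open>B\<close>
  and all sizes are determined by \<open>P\<close>, \<open>A\<close> and \<open>G\<close>, so the outer existential quantifier only
  names them.\<close>

definition linearization ::
  "'a::field poly mat \<Rightarrow> 'a ratfun mat \<Rightarrow> 'a poly mat \<Rightarrow> 'a set \<Rightarrow> bool" where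
  "linearization P G A \<Sigma> \<longleftrightarrow>
     \<Sigma> \<noteq> {} \<and> linear_poly_mat P \<and>
     (\<exists>m n q t D C B. G \<in> carrier_mat m m \<and> system_matrix n q t P D C B A \<and>
       (\<forall>x\<in>\<Sigma>. minimal_at C B A x \<and>
         (\<exists>s1 s2 R1 R2.
            int s1 - int s2 = int q - int m \<and> int s1 - int s2 = int t - int m \<and>
            R1 \<in> carrier_mat (m + s1) (m + s1) \<and> R2 \<in> carrier_mat (m + s1) (m + s1) \<and>
            regular_at R1 x \<and> regular_at R2 x \<and>
            R1 * diag_id G s1 * R2 = diag_id (transfer_function D C B A) s2)))"


section \<open>The low-rank rational matrix and its pencil\<close>

text \<open>A pole in \<open>\<F> \<union> {\<infinity>}\<close> is encoded as an option value, with \<open>None\<close> standing for \<open>\<infinity>\<close>.\<close>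

definition g_poly :: "(nat \<Rightarrow> 'a::field) \<Rightarrow> (nat \<Rightarrow> 'a option) \<Rightarrow> nat \<Rightarrow> 'a poly" where
  "g_poly \<beta> \<xi> i = Polynomial.smult (\<beta> i) (case \<xi> i of None \<Rightarrow> 1 | Some z \<Rightarrow> [:1, - (1 / z):])"

definition h_poly :: "(nat \<Rightarrow> 'a::field) \<Rightarrow> nat \<Rightarrow> 'a poly" where
  "h_poly \<sigma> j = [:- \<sigma> j, 1:]"

definition finite_poles :: "(nat \<Rightarrow> 'a option) \<Rightarrow> nat \<Rightarrow> 'a set" where
  "finite_poles \<xi> k = {z. \<exists>i\<in>{1..k}. \<xi> i = Some z}"

context
  fixes m r p N :: nat
    and \<sigma> \<beta> :: "nat \<Rightarrow> 'a::field"
    and \<xi> :: "nat \<Rightarrow> 'a option"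
    and D L :: "nat \<Rightarrow> 'a mat"
    and U :: "'a mat"
begin

private abbreviation "g \<equiv> g_poly \<beta> \<xi>"
private abbreviation "h \<equiv> h_poly \<sigma>"
private abbreviation "gr i \<equiv> to_fract (g i)"
private abbreviation "hr i \<equiv> to_fract (h i)"
private abbreviation "pmat \<equiv> map_mat (\<lambda>c. [:c:])"

definition b_fun :: "nat \<Rightarrow> 'a ratfun" where
  "b_fun i = const_ratfun (1 / \<beta> 0) * (\<Prod>k=1..i. hr (k - 1) / gr k)"

definition Q_mat :: "'a ratfun mat" where
  "Q_mat = mat m m (\<lambda>ij.
     (\<Sum>i=0..p. b_fun i * const_ratfun (D i $$ ij)) +
     (\<Sum>i=p+1..N. b_fun i * const_ratfun ((L i * U\<^sup>T) $$ ij)))"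

definition M_block :: "nat \<Rightarrow> 'a poly mat" where
  "M_block j =
     (let gN = Polynomial.smult (1 / \<beta> N) (g N); hN = Polynomial.smult (1 / \<beta> N) (h (N - 1)) in
      if j \<le> p then gN \<cdot>\<^sub>m pmat (D j)
      else if j < N - 1 then gN \<cdot>\<^sub>m pmat (L j)
      else gN \<cdot>\<^sub>m pmat (L (N - 1)) + hN \<cdot>\<^sub>m pmat (L N))"

definition M_mat :: "'a poly mat" where
  "M_mat = hconcat m (map M_block [0..<N])"

text \<open>The block rows of \<open>K\<close> are numbered \<open>1, \<dots>, N - 1\<close> and its block columns
  \<open>0, \<dots>, N - 1\<close>, so that row \<open>i\<close> contains \<open>- h\<^sub>i\<^sub>-\<^sub>1\<close> and \<open>g\<^sub>i\<close> in columns \<open>i - 1\<close> and \<open>i\<close>.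
  Block row and block column \<open>i\<close> have the same size.\<close>

definition block_size :: "nat \<Rightarrow> nat" where
  "block_size i = (if i \<le> p then m else r)"

definition K_block :: "nat \<Rightarrow> nat \<Rightarrow> 'a poly mat" where
  "K_block i j =
     (if j + 1 = i then (if i = p + 1 then - h p \<cdot>\<^sub>m pmat (U\<^sup>T)
                         else - h (i - 1) \<cdot>\<^sub>m 1\<^sub>m (block_size i))
      else if j = i then g i \<cdot>\<^sub>m 1\<^sub>m (block_size i)
      else 0\<^sub>m (block_size i) (block_size j))"

definition K_mat :: "'a poly mat" where
  "K_mat = vconcat (\<Sum>j<N. block_size j)
     (map (\<lambda>i. hconcat (block_size i) (map (K_block i) [0..<N])) [1..<N])"

definition L_pencil :: "'a poly mat" where
  "L_pencil = M_mat @\<^sub>r K_mat"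

definition A_mat :: "'a poly mat" where
  "A_mat = mat (dim_row K_mat) (dim_col K_mat - m) (\<lambda>(i,j). K_mat $$ (i, j + m))"

definition R1_mat :: "'a ratfun mat" where
  "R1_mat = (gr N / hr (N - 1)) \<cdot>\<^sub>m
     mat m m (\<lambda>ij.
       (\<Sum>j=1..p-1. (\<Prod>k=j+1..p. gr k / hr (k - 1)) * const_ratfun (D j $$ ij)) +
       const_ratfun (D p $$ ij))"

definition R2_mat :: "'a ratfun mat" where
  "R2_mat = mat m r (\<lambda>ij.
     (\<Sum>j=p+1..N-1. (\<Prod>k=j+1..N. gr k / hr (k - 1)) * const_ratfun (L j $$ ij)) +
     const_ratfun (L N $$ ij))"

definition R_mat :: "'a ratfun mat" where
  "R_mat =
     (R1_mat @\<^sub>c R2_mat) @\<^sub>r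
     ((((\<Prod>i=1..p-1. gr i / hr i) * gr p) \<cdot>\<^sub>m 1\<^sub>m m) @\<^sub>c 0\<^sub>m m r) @\<^sub>r
     ((- hr p \<cdot>\<^sub>m map_mat const_ratfun (U\<^sup>T)) @\<^sub>c
      (((\<Prod>i=p+1..N-2. gr i / hr i) * gr (N - 1)) \<cdot>\<^sub>m 1\<^sub>m r))"

end

end

theory Submission
  imports Defs
begin

text \<open>Minimality and the transfer function both come from solving two-term recurrences. A block
  vector \<open>w\<close> is annihilated by the block rows of \<open>K\<close> iff \<open>g\<^sub>i w\<^sub>i = h\<^sub>i\<^sub>-\<^sub>1 w\<^sub>i\<^sub>-\<^sub>1\<close>, with \<open>U\<^sup>T\<close> inserted
  on the right at \<open>i = p + 1\<close>. Over the field of rational functions, with \<open>w\<^sub>0 = I\<close>, the solution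
  is \<open>\<beta>\<^sub>0\<close> times the column of the \<open>b\<^sub>i I\<close> (\<open>i \<le> p\<close>) and the \<open>b\<^sub>i U\<^sup>T\<close> (\<open>i > p\<close>), and applying \<open>M\<close> to it
  shows that the transfer function is \<open>(\<beta>\<^sub>0 g\<^sub>N / \<beta>\<^sub>N) Q\<close>. The scalar factor is regular away from
  \<open>\<xi>\<^sub>N\<close>, so \<open>s\<^sub>1 = s\<^sub>2 = 0\<close> suffices. At a point that is no pole, \<open>A\<close> is invertible; at a pole the
  recurrences can be run backwards because the \<open>h\<^sub>j\<close> do not vanish, and they reduce the kernel of the
  columns of \<open>A\<close> and \<open>C\<close> to the kernel of \<open>R\<close>. The rows of \<open>K\<close> are independent at every point since
  the \<open>g\<^sub>i\<close> and the \<open>h\<^sub>j\<close> never vanish simultaneously and \<open>U\<close> has full column rank.\<close>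

section \<open>Full rank and trivial kernels\<close>

text \<open>The rank is computed from the set of columns, so a repeated column has to be excluded in
  both directions. Full rank forces an independent subset with \<open>nc\<close> elements, hence
  \<open>nc\<close> distinct columns; a trivial kernel excludes a repetition because the difference
  of two unit vectors would lie in it.\<close>

lemma mat_rank_eq_dim_col_iff:
  assumes A: "(A :: 'a::field mat) \<in> carrier_mat nr nc"
  shows "mat_rank A = nc \<longleftrightarrow> (\<forall>v \<in> carrier_vec nc. A *\<^sub>v v = 0\<^sub>v nr \<longrightarrow> v = 0\<^sub>v nc)"
proof -
  interpret vec_space "TYPE('a)" nr .
  have rank: "mat_rank A = rank A" using A by (simp add: mat_rank_def)
  show ?thesis
  proof
    assume full: "mat_rank A = nc"
    obtain S where S: "maximal S (\<lambda>T. T \<subseteq> set (cols A) \<and> lin_indpt T)"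
      using maximal_exists_superset[of "set (cols A)" "\<lambda>T. T \<subseteq> set (cols A) \<and> lin_indpt T" "{}"]
      by (meson List.finite_set empty_subsetI finite_lin_indpt2 finite.emptyI empty_iff)
    have "S \<subseteq> set (cols A)" using S by (simp add: maximal_def)
    then have "card S \<le> card (set (cols A))" by (simp add: card_mono)
    then have "length (cols A) \<le> card (set (cols A))"
      using full rank rank_card_indpt[OF A S] A by simp
    then have "distinct (cols A)" by (meson card_distinct card_length le_antisym)
    then show "\<forall>v \<in> carrier_vec nc. A *\<^sub>v v = 0\<^sub>v nr \<longrightarrow> v = 0\<^sub>v nc"
      using full_rank_lin_indpt[OF A] lin_depI[OF A] full rank by metis
  next
    assume ker: "\<forall>v \<in> carrier_vec nc. A *\<^sub>v v = 0\<^sub>v nr \<longrightarrow> v = 0\<^sub>v nc"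
    have "distinct (cols A)"
    proof (rule ccontr)
      assume "\<not> distinct (cols A)"
      then obtain i j where ij: "i < nc" "j < nc" "i \<noteq> j" "col A i = col A j"
        using A by (auto simp: distinct_conv_nth)
      \<comment> \<open>Columns \<open>i\<close> and \<open>j\<close> agree, so this nonzero vector
        is annihilated by \<open>A\<close>.\<close>
      define v where "v = unit_vec nc i - (unit_vec nc j :: 'a vec)"
      have v: "v \<in> carrier_vec nc" by (simp add: v_def)
      have "A *\<^sub>v v = 0\<^sub>v nr"
      proof (rule eq_vecI)
        fix k assume k: "k < dim_vec (0\<^sub>v nr :: 'a vec)"
        have "A $$ (k,i) = A $$ (k,j)"
          using index_col[of k A i] index_col[of k A j] A k ij
          by (metis carrier_matD dim_vec index_zero_vec(2))
        then show "(A *\<^sub>v v) $ k = 0\<^sub>v nr $ k"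
          using A k ij unfolding v_def
          by (simp add: scalar_prod_minus_distrib[of _ nc] scalar_prod_right_unit)
      qed (use A in simp)
      then have "v = 0\<^sub>v nc" using ker v by blast
      then have "v $ i = 0" using ij by simp
      then show False using ij by (simp add: v_def)
    qed
    then show "mat_rank A = nc"
      using lin_indpt_full_rank[OF A] lin_depE[OF A] ker rank by metis
  qed
qed

text \<open>If the rank were smaller than \<open>nr\<close>, a maximal independent set of columns
  would span a proper subspace containing all columns. Some nonzero \<open>y\<close> is then
  orthogonal to every column, against the hypothesis.\<close>

lemma mat_rank_eq_dim_row:
  assumes A: "(A :: 'a::field mat) \<in> carrier_mat nr nc"
    and ker: "\<And>y. y \<in> carrier_vec nr \<Longrightarrow> (\<And>j. j < nc \<Longrightarrow> col A j \<bullet> y = 0) \<Longrightarrow> y = 0\<^sub>v nr"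
  shows "mat_rank A = nr"
proof -
  interpret vec_space "TYPE('a)" nr .
  have rank: "mat_rank A = rank A" using A by (simp add: mat_rank_def)
  obtain S where S: "maximal S (\<lambda>T. T \<subseteq> set (cols A) \<and> lin_indpt T)"
    using maximal_exists_superset[of "set (cols A)" "\<lambda>T. T \<subseteq> set (cols A) \<and> lin_indpt T" "{}"]
    by (meson List.finite_set empty_subsetI finite_lin_indpt2 finite.emptyI empty_iff)
  then have SA: "S \<subseteq> set (cols A)" and indpt: "lin_indpt S" by (simp_all add: maximal_def)
  have colsA: "set (cols A) \<subseteq> carrier_vec nr" using cols_dim A by blast
  have Sc: "S \<subseteq> carrier_vec nr" using SA colsA by blast
  have finS: "finite S" using SA finite_subset by blast
  have cardS: "card S = rank A" using rank_card_indpt[OF A S] by simp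
  have le: "card S \<le> nr" using li_le_dim(2)[OF fin_dim Sc indpt] dim_is_n by simp
  have colS: "c \<in> span S" if c: "c \<in> set (cols A)" for c
  proof (rule ccontr)
    assume n: "c \<notin> span S"
    have cc: "c \<in> carrier_vec nr" using c colsA by blast
    have cS: "c \<notin> S" using n span_mem[OF Sc] by blast
    have "lin_indpt (S \<union> {c})" using lin_dep_iff_in_span[OF Sc indpt cc cS] n by blast
    then show False using S c SA cS unfolding maximal_def by blast
  qed
  have "card S = nr"
  proof (rule ccontr)
    assume "card S \<noteq> nr"
    then have lt: "card S < nr" using le by simp
    obtain xs where xs: "set xs = S" "distinct xs" using finite_distinct_list[OF finS] by blast
    have len: "length xs = card S" using xs distinct_card by force
    \<comment> \<open>Padding the independent columns with at least one zero column gives a square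
      singular matrix \<open>B\<close> with the same column space as \<open>A\<close>. A nonzero
      kernel vector of its transpose is the required \<open>y\<close>.\<close>
    define ys where "ys = xs @ replicate (nr - card S) (0\<^sub>v nr)"
    define B where "B = mat_of_cols nr ys"
    have len_ys: "length ys = nr" using len lt by (simp add: ys_def)
    have B: "B \<in> carrier_mat nr nr" unfolding B_def using mat_of_cols_carrier(1)[of nr ys] len_ys by metis
    have ysc: "set ys \<subseteq> carrier_vec nr" using xs(1) Sc by (auto simp: ys_def)
    have colsB: "cols B = ys" using ysc by (simp add: B_def cols_mat_of_cols)
    have "\<not> nr - 1 < length xs" using len lt by simp
    then have nth: "ys ! (nr - 1) = 0\<^sub>v nr" using len lt by (simp only: ys_def nth_append) simp
    have "B *\<^sub>v unit_vec nr (nr - 1) = col B (nr - 1)"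
      using B lt by (intro eq_vecI) auto
    also have "\<dots> = 0\<^sub>v nr"
      using nth cols_nth[of "nr - 1" B] colsB B lt by simp
    finally have "B *\<^sub>v unit_vec nr (nr - 1) = 0\<^sub>v nr" .
    moreover have "unit_vec nr (nr - 1) \<noteq> (0\<^sub>v nr :: 'a vec)"
      using lt by (intro notI) (drule arg_cong[of _ _ "\<lambda>v. v $ (nr - 1)"], simp)
    ultimately have "det B = 0"
      using det_0_iff_vec_prod_zero[OF B] unit_vec_carrier by blast
    then have "det B\<^sup>T = 0" using det_transpose[OF B] by simp
    then obtain y where y: "y \<in> carrier_vec nr" "y \<noteq> 0\<^sub>v nr" "B\<^sup>T *\<^sub>v y = 0\<^sub>v nr"
      using det_0_iff_vec_prod_zero[of "B\<^sup>T" nr] B by auto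
    have "col A j \<bullet> y = 0" if j: "j < nc" for j
    proof -
      have "col A j \<in> set (cols A)" using A j by (auto simp: cols_def)
      moreover have "span S \<subseteq> span (set (cols B))"
        using xs(1) by (intro span_is_monotone) (auto simp: colsB ys_def)
      ultimately have "col A j \<in> col_space B" using colS unfolding col_space_def by blast
      then obtain x where x: "x \<in> carrier_vec nr" "B *\<^sub>v x = col A j"
        using col_space_eq[OF B] B by auto
      have "y \<bullet> (B *\<^sub>v x) = (B\<^sup>T *\<^sub>v y) \<bullet> x"
        using transpose_vec_mult_scalar[OF B x(1) y(1)] by simp
      also have "\<dots> = 0" using x(1) y(3) by simp
      finally have "y \<bullet> col A j = 0" using x(2) by simp
      moreover have "col A j \<in> carrier_vec nr" using x(2) B x(1) by (metis mult_mat_vec_carrier)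
      ultimately show ?thesis using comm_scalar_prod y(1) by metis
    qed
    then show False using ker y by blast
  qed
  then show ?thesis using cardS rank by simp
qed

section \<open>Block indexing\<close>

lemma sum_lessThan_add:
  fixes f :: "nat \<Rightarrow> 'b::comm_monoid_add"
  shows "sum f {..<x + y} = sum f {..<x} + (\<Sum>l<y. f (x + l))"
proof (induction y)
  case (Suc y)
  then show ?case unfolding add_Suc_right by (simp add: add.assoc)
qed simp

text \<open>Turns the flat sum of a matrix product into a double sum over blocks and local indices,
  in which the block equations can be read off.\<close>

lemma sum_blocks:
  fixes f :: "nat \<Rightarrow> 'b::comm_monoid_add" and s :: "nat \<Rightarrow> nat"
  assumes "a \<le> b"
  shows "sum f {..<sum s {a..<b}} = (\<Sum>j=a..<b. \<Sum>l<s j. f (sum s {a..<j} + l))"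
  using assms
proof (induction b rule: dec_induct)
  case (step b)
  then show ?case by (simp only: sum.atLeastLessThan_Suc sum_lessThan_add)
qed simp

lemma block_index_less:
  fixes s :: "nat \<Rightarrow> nat"
  assumes "a \<le> j" "j < b" "l < s j"
  shows "sum s {a..<j} + l < sum s {a..<b}"
proof -
  have "sum s {a..<j} + l < sum s {a..<Suc j}" using assms by simp
  also have "\<dots> \<le> sum s {a..<b}" using assms by (intro sum_mono2) auto
  finally show ?thesis .
qed

lemma block_index_cases:
  fixes s :: "nat \<Rightarrow> nat"
  assumes "k < sum s {a..<b}"
  obtains j l where "a \<le> j" "j < b" "l < s j" "k = sum s {a..<j} + l"
proof -
  have "\<exists>j l. a \<le> j \<and> j < b \<and> l < s j \<and> k = sum s {a..<j} + l"
    using assms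
  proof (induction b)
    case (Suc b)
    show ?case
    proof (cases "k < sum s {a..<b}")
      case True
      then show ?thesis using Suc.IH less_SucI by blast
    next
      case False
      have ab: "a \<le> b" using Suc.prems by (cases "a \<le> b") auto
      then have "k - sum s {a..<b} < s b" using Suc.prems False by simp
      then show ?thesis using ab False
        by (intro exI[of _ b] exI[of _ "k - sum s {a..<b}"]) simp
    qed
  qed simp
  then show ?thesis using that by blast
qed

section \<open>Entries of concatenated blocks\<close>

lemma append_cols_carrier:
  assumes "A \<in> carrier_mat nr nc1" "B \<in> carrier_mat nr nc2"
  shows "A @\<^sub>c B \<in> carrier_mat nr (nc1 + nc2)"
  using four_block_carrier_mat[OF assms(1), of "0\<^sub>m 0 (dim_col B)" 0 nc2 B "0\<^sub>m 0 (dim_col A)"] assms(2)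
  unfolding append_cols_def by simp

lemma append_cols_index:
  assumes "A \<in> carrier_mat nr nc1" "B \<in> carrier_mat nr nc2" "i < nr" "j < nc1 + nc2"
  shows "(A @\<^sub>c B) $$ (i,j) = (if j < nc1 then A $$ (i,j) else B $$ (i, j - nc1))"
proof -
  have "dim_row A = nr" "dim_col A = nc1" "dim_row B = nr" "dim_col B = nc2"
    using assms(1,2) by simp_all
  then show ?thesis unfolding append_cols_def
    using assms(3,4) by (subst index_mat_four_block(1)) simp_all
qed

lemma append_rows_index:
  assumes "A \<in> carrier_mat nr1 nc" "B \<in> carrier_mat nr2 nc" "i < nr1 + nr2" "j < nc"
  shows "(A @\<^sub>r B) $$ (i,j) = (if i < nr1 then A $$ (i,j) else B $$ (i - nr1, j))"
proof -
  have "dim_row A = nr1" "dim_col A = nc" "dim_row B = nr2" "dim_col B = nc"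
    using assms(1,2) by simp_all
  then show ?thesis unfolding append_rows_def
    using assms(3,4) by (subst index_mat_four_block(1)) simp_all
qed

lemma hconcat_carrier:
  assumes "\<And>j. a \<le> j \<Longrightarrow> j < b \<Longrightarrow> B j \<in> carrier_mat nr (s j)" "a \<le> b"
  shows "hconcat nr (map B [a..<b]) \<in> carrier_mat nr (sum s {a..<b})"
  using assms(2,1)
proof (induction rule: inc_induct)
  case (step a)
  have "hconcat nr (map B [a..<b]) = B a @\<^sub>c hconcat nr (map B [Suc a..<b])"
    unfolding upt_conv_Cons[OF step.hyps(2)] hconcat_def by simp
  moreover have "B a \<in> carrier_mat nr (s a)" using step.prems step.hyps by blast
  moreover have "hconcat nr (map B [Suc a..<b]) \<in> carrier_mat nr (sum s {Suc a..<b})"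
    by (rule step.IH) (rule step.prems(1), simp_all)
  ultimately show ?case
    unfolding sum.atLeast_Suc_lessThan[OF step.hyps(2)] by (simp only: append_cols_carrier)
qed (simp add: hconcat_def)

text \<open>Splitting off the first block shifts all later offsets by \<open>s a\<close>. The
  induction therefore lowers the left end \<open>a\<close> and keeps \<open>b\<close> fixed. The
  widths \<open>s j\<close> may vary, as they do for the pencil when \<open>m\<close> changes to
  \<open>r\<close>.\<close>

lemma hconcat_index:
  assumes "\<And>j. a \<le> j \<Longrightarrow> j < b \<Longrightarrow> B j \<in> carrier_mat nr (s j)"
    and "i < nr" "a \<le> j" "j < b" "l < s j"
  shows "hconcat nr (map B [a..<b]) $$ (i, sum s {a..<j} + l) = B j $$ (i,l)"
proof -
  have "a \<le> b" using assms(3,4) by (rule order.trans[OF _ less_imp_le])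
  then show ?thesis using assms
  proof (induction rule: inc_induct)
    case (step a)
    let ?R = "hconcat nr (map B [Suc a..<b])"
    have B: "B a \<in> carrier_mat nr (s a)" using step.prems(1) step.hyps by blast
    have R: "?R \<in> carrier_mat nr (sum s {Suc a..<b})"
      using step.hyps by (intro hconcat_carrier step.prems(1)) auto
    have split: "hconcat nr (map B [a..<b]) = B a @\<^sub>c ?R"
      unfolding upt_conv_Cons[OF step.hyps(2)] hconcat_def by simp
    have lt: "sum s {a..<j} + l < s a + sum s {Suc a..<b}"
      using block_index_less[of a j b l s] step.prems(3-5)
      unfolding sum.atLeast_Suc_lessThan[OF step.hyps(2)] by blast
    show ?case
    proof (cases "j = a")
      case True
      then show ?thesis unfolding split using append_cols_index[OF B R _ lt] step.prems(2,5) by simp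
    next
      case False
      then have aj: "a < j" using step.prems(3) by simp
      have eq: "sum s {a..<j} = s a + sum s {Suc a..<j}"
        by (rule sum.atLeast_Suc_lessThan[OF aj])
      have "hconcat nr (map B [Suc a..<b]) $$ (i, sum s {Suc a..<j} + l) = B j $$ (i,l)"
        using aj step.prems(2-5) by (intro step.IH step.prems(1)) auto
      then show ?thesis unfolding split eq
        using append_cols_index[OF B R _ lt[unfolded eq]] step.prems(2) by simp
    qed
  next
    case base
    show ?case using base.prems(3,4) by simp
  qed
qed

lemma vconcat_carrier:
  assumes "\<And>j. a \<le> j \<Longrightarrow> j < b \<Longrightarrow> B j \<in> carrier_mat (s j) nc" "a \<le> b"
  shows "vconcat nc (map B [a..<b]) \<in> carrier_mat (sum s {a..<b}) nc"
  using assms(2,1)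
proof (induction rule: inc_induct)
  case (step a)
  have "vconcat nc (map B [a..<b]) = B a @\<^sub>r vconcat nc (map B [Suc a..<b])"
    unfolding upt_conv_Cons[OF step.hyps(2)] vconcat_def by simp
  moreover have "B a \<in> carrier_mat (s a) nc" using step.prems step.hyps by blast
  moreover have "vconcat nc (map B [Suc a..<b]) \<in> carrier_mat (sum s {Suc a..<b}) nc"
    by (rule step.IH) (rule step.prems(1), simp_all)
  ultimately show ?case
    unfolding sum.atLeast_Suc_lessThan[OF step.hyps(2)] by (simp only: carrier_append_rows)
qed (simp add: vconcat_def)

lemma vconcat_index:
  assumes "\<And>j. a \<le> j \<Longrightarrow> j < b \<Longrightarrow> B j \<in> carrier_mat (s j) nc"
    and "i < nc" "a \<le> j" "j < b" "l < s j"
  shows "vconcat nc (map B [a..<b]) $$ (sum s {a..<j} + l, i) = B j $$ (l,i)"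
proof -
  have "a \<le> b" using assms(3,4) by (rule order.trans[OF _ less_imp_le])
  then show ?thesis using assms
  proof (induction rule: inc_induct)
    case (step a)
    let ?R = "vconcat nc (map B [Suc a..<b])"
    have B: "B a \<in> carrier_mat (s a) nc" using step.prems(1) step.hyps by blast
    have R: "?R \<in> carrier_mat (sum s {Suc a..<b}) nc"
      using step.hyps by (intro vconcat_carrier step.prems(1)) auto
    have split: "vconcat nc (map B [a..<b]) = B a @\<^sub>r ?R"
      unfolding upt_conv_Cons[OF step.hyps(2)] vconcat_def by simp
    have lt: "sum s {a..<j} + l < s a + sum s {Suc a..<b}"
      using block_index_less[of a j b l s] step.prems(3-5)
      unfolding sum.atLeast_Suc_lessThan[OF step.hyps(2)] by blast
    show ?case
    proof (cases "j = a")
      case True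
      then show ?thesis unfolding split using append_rows_index[OF B R lt] step.prems(2,5) by simp
    next
      case False
      then have aj: "a < j" using step.prems(3) by simp
      have eq: "sum s {a..<j} = s a + sum s {Suc a..<j}"
        by (rule sum.atLeast_Suc_lessThan[OF aj])
      have "vconcat nc (map B [Suc a..<b]) $$ (sum s {Suc a..<j} + l, i) = B j $$ (l,i)"
        using aj step.prems(2-5) by (intro step.IH step.prems(1)) auto
      then show ?thesis unfolding split eq
        using append_rows_index[OF B R lt[unfolded eq]] step.prems(2) by simp
    qed
  next
    case base
    show ?case using base.prems(3,4) by simp
  qed
qed

section \<open>Evaluating rational functions\<close>

lemma ratfun_defined_atE:
  assumes "ratfun_defined_at f x"
  obtains u v where "poly v x \<noteq> 0" "v \<noteq> 0" "f = Fraction_Field.Fract u v"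
    "ratfun_eval f x = poly u x / poly v x"
proof -
  obtain u v where uv: "poly v x \<noteq> 0" "f = Fraction_Field.Fract u v"
    using assms unfolding ratfun_defined_at_def by blast
  moreover from uv(1) have "v \<noteq> 0" by auto
  ultimately show ?thesis using that ratfun_eval_Fract by blast
qed

lemma ratfun_defined_at_Fract: "poly v x \<noteq> 0 \<Longrightarrow> ratfun_defined_at (Fraction_Field.Fract u v) x"
  unfolding ratfun_defined_at_def by blast

lemma ratfun_to_fract:
  "ratfun_defined_at (to_fract u) x" "ratfun_eval (to_fract u) x = poly u x"
  using ratfun_defined_at_Fract[of 1 x u] ratfun_eval_Fract[of 1 x u]
  by (simp_all add: to_fract_def)

lemma ratfun_add:
  assumes "ratfun_defined_at f x" "ratfun_defined_at g x"
  shows "ratfun_defined_at (f + g) x"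
    "ratfun_eval (f + g) x = ratfun_eval f x + ratfun_eval g x"
proof -
  from assms obtain u v u' v' where
    v: "poly v x \<noteq> 0" "v \<noteq> 0" "f = Fraction_Field.Fract u v"
      "ratfun_eval f x = poly u x / poly v x"
    and v': "poly v' x \<noteq> 0" "v' \<noteq> 0" "g = Fraction_Field.Fract u' v'"
      "ratfun_eval g x = poly u' x / poly v' x"
    by (meson ratfun_defined_atE)
  have eq: "f + g = Fraction_Field.Fract (u * v' + u' * v) (v * v')"
    using v(2,3) v'(2,3) by simp
  have nz: "poly (v * v') x \<noteq> 0" using v(1) v'(1) by simp
  show "ratfun_defined_at (f + g) x" unfolding eq by (rule ratfun_defined_at_Fract[OF nz])
  show "ratfun_eval (f + g) x = ratfun_eval f x + ratfun_eval g x"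
    unfolding eq ratfun_eval_Fract[OF nz] v(4) v'(4) using v(1) v'(1) by (simp add: add_frac_eq)
qed

lemma ratfun_mult:
  assumes "ratfun_defined_at f x" "ratfun_defined_at g x"
  shows "ratfun_defined_at (f * g) x"
    "ratfun_eval (f * g) x = ratfun_eval f x * ratfun_eval g x"
proof -
  from assms obtain u v u' v' where
    v: "poly v x \<noteq> 0" "v \<noteq> 0" "f = Fraction_Field.Fract u v"
      "ratfun_eval f x = poly u x / poly v x"
    and v': "poly v' x \<noteq> 0" "v' \<noteq> 0" "g = Fraction_Field.Fract u' v'"
      "ratfun_eval g x = poly u' x / poly v' x"
    by (meson ratfun_defined_atE)
  have eq: "f * g = Fraction_Field.Fract (u * u') (v * v')"
    using v(2,3) v'(2,3) by simp
  have nz: "poly (v * v') x \<noteq> 0" using v(1) v'(1) by simp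
  show "ratfun_defined_at (f * g) x" unfolding eq by (rule ratfun_defined_at_Fract[OF nz])
  show "ratfun_eval (f * g) x = ratfun_eval f x * ratfun_eval g x"
    unfolding eq ratfun_eval_Fract[OF nz] v(4) v'(4) using v(1) v'(1) by (simp add: add_frac_eq)
qed

lemma ratfun_to_fract_divide:
  assumes "poly v x \<noteq> 0"
  shows "ratfun_defined_at (to_fract u / to_fract v) x"
    "ratfun_eval (to_fract u / to_fract v) x = poly u x / poly v x"
  unfolding Fract_conv_to_fract[symmetric]
  using assms by (rule ratfun_defined_at_Fract, rule ratfun_eval_Fract)

lemma ratfun_const:
  "ratfun_defined_at (const_ratfun c) x" "ratfun_eval (const_ratfun c) x = c"
  by (simp_all add: const_ratfun_def ratfun_to_fract)

lemma ratfun_sum: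
  assumes "\<And>i. i \<in> I \<Longrightarrow> ratfun_defined_at (f i) x"
  shows "ratfun_defined_at (sum f I) x \<and> ratfun_eval (sum f I) x = (\<Sum>i\<in>I. ratfun_eval (f i) x)"
  using assms
proof (induction I rule: infinite_finite_induct)
  case (insert i I)
  then show ?case by (simp add: ratfun_add)
qed (use ratfun_to_fract[of 0 x] in simp_all)

lemma ratfun_prod:
  assumes "\<And>i. i \<in> I \<Longrightarrow> ratfun_defined_at (f i) x"
  shows "ratfun_defined_at (prod f I) x \<and> ratfun_eval (prod f I) x = (\<Prod>i\<in>I. ratfun_eval (f i) x)"
  using assms
proof (induction I rule: infinite_finite_induct)
  case (insert i I)
  then show ?case by (simp add: ratfun_mult)
qed (use ratfun_to_fract[of 1 x] in simp_all)

section \<open>The blocks of the pencil\<close>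

locale low_rank_pencil =
  fixes m r p N :: nat
    and \<sigma> \<beta> :: "nat \<Rightarrow> 'a::field"
    and \<xi> :: "nat \<Rightarrow> 'a option"
    and D L :: "nat \<Rightarrow> 'a mat"
    and U :: "'a mat"
  assumes p_ge: "1 \<le> p" and N_ge: "p + 2 \<le> N"
    and D_carrier: "\<And>i. i \<le> p \<Longrightarrow> D i \<in> carrier_mat m m"
    and L_carrier: "\<And>i. p < i \<Longrightarrow> i \<le> N \<Longrightarrow> L i \<in> carrier_mat m r"
    and U_carrier: "U \<in> carrier_mat m r"
    and U_rank: "mat_rank U = r"
    and \<xi>_nonzero: "\<And>i. 1 \<le> i \<Longrightarrow> i \<le> N \<Longrightarrow> \<xi> i \<noteq> Some 0"
    and \<beta>_nonzero: "\<And>i. i \<le> N \<Longrightarrow> \<beta> i \<noteq> 0"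
    and \<xi>_ne_\<sigma>: "\<And>i j. 1 \<le> i \<Longrightarrow> i \<le> N \<Longrightarrow> j < N \<Longrightarrow> \<xi> i \<noteq> Some (\<sigma> j)"
begin

abbreviation "g \<equiv> g_poly \<beta> \<xi>"
abbreviation "h \<equiv> h_poly \<sigma>"
abbreviation "bs \<equiv> block_size m r p"
abbreviation "Mb \<equiv> M_block p N \<sigma> \<beta> \<xi> D L"
abbreviation "Kb \<equiv> K_block m r p \<sigma> \<beta> \<xi> U"
abbreviation "M \<equiv> M_mat m p N \<sigma> \<beta> \<xi> D L"
abbreviation "K \<equiv> K_mat m r p N \<sigma> \<beta> \<xi> U"
abbreviation "A \<equiv> A_mat m r p N \<sigma> \<beta> \<xi> U"
abbreviation "n \<equiv> sum bs {1..<N}"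
abbreviation "gN \<equiv> Polynomial.smult (1 / \<beta> N) (g N)"
abbreviation "hN \<equiv> Polynomial.smult (1 / \<beta> N) (h (N - 1))"

lemma M_block_carrier: "j < N \<Longrightarrow> Mb j \<in> carrier_mat m (bs j)"
  using D_carrier[of j] L_carrier[of j] L_carrier[of "N - 1"] L_carrier[of N] N_ge
  by (auto simp: M_block_def block_size_def Let_def)

lemma K_block_carrier: "Kb i j \<in> carrier_mat (bs i) (bs j)"
  using U_carrier by (auto simp: K_block_def block_size_def)

text \<open>Block columns are counted from 0 and block rows from 1, and column 0 has width
  \<open>m\<close>. This is the shift by \<open>m\<close> that separates the column offsets of
  \<open>K\<close> from those of \<open>A\<close>.\<close>

lemma sum_bs_from_0: "1 \<le> j \<Longrightarrow> sum bs {0..<j} = m + sum bs {1..<j}"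
  by (simp add: sum.atLeast_Suc_lessThan block_size_def)

lemma M_carrier: "M \<in> carrier_mat m (sum bs {0..<N})"
  unfolding M_mat_def by (rule hconcat_carrier) (simp_all add: M_block_carrier)

lemma M_index:
  assumes "a < m" "j < N" "l < bs j"
  shows "M $$ (a, sum bs {0..<j} + l) = Mb j $$ (a,l)"
  unfolding M_mat_def by (rule hconcat_index) (use assms in \<open>simp_all add: M_block_carrier\<close>)

lemma K_row_carrier: "hconcat (bs i) (map (Kb i) [0..<N]) \<in> carrier_mat (bs i) (sum bs {0..<N})"
  by (rule hconcat_carrier) (simp_all add: K_block_carrier)

lemma K_carrier: "K \<in> carrier_mat n (sum bs {0..<N})"
  unfolding K_mat_def lessThan_atLeast0 using N_ge
  by (intro vconcat_carrier K_row_carrier) simp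

lemma K_index:
  assumes "1 \<le> i" "i < N" "a < bs i" "j < N" "l < bs j"
  shows "K $$ (sum bs {1..<i} + a, sum bs {0..<j} + l) = Kb i j $$ (a,l)"
proof -
  have "K $$ (sum bs {1..<i} + a, sum bs {0..<j} + l) =
      hconcat (bs i) (map (Kb i) [0..<N]) $$ (a, sum bs {0..<j} + l)"
    unfolding K_mat_def lessThan_atLeast0
    by (rule vconcat_index)
      (rule K_row_carrier, use assms block_index_less[of 0 j N l bs] in simp_all)
  also have "\<dots> = Kb i j $$ (a,l)"
    by (rule hconcat_index) (use assms in \<open>simp_all add: K_block_carrier\<close>)
  finally show ?thesis .
qed

lemma A_carrier: "A \<in> carrier_mat n n"
  using K_carrier sum_bs_from_0[of N] N_ge by (simp add: A_mat_def)

lemma A_index: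
  assumes "1 \<le> i" "i < N" "a < bs i" "1 \<le> j" "j < N" "l < bs j"
  shows "A $$ (sum bs {1..<i} + a, sum bs {1..<j} + l) = Kb i j $$ (a,l)"
proof -
  have "sum bs {1..<i} + a < n" "sum bs {1..<j} + l < n"
    using assms by (auto intro!: block_index_less)
  then have "A $$ (sum bs {1..<i} + a, sum bs {1..<j} + l) =
      K $$ (sum bs {1..<i} + a, sum bs {1..<j} + l + m)"
    using K_carrier sum_bs_from_0[of N] N_ge by (simp add: A_mat_def)
  also have "sum bs {1..<j} + l + m = sum bs {0..<j} + l"
    using sum_bs_from_0[of j] assms by simp
  finally show ?thesis using K_index assms by simp
qed

text \<open>Row \<open>i\<close> has only two nonzero blocks, the diagonal one and its left
  neighbour. The homomorphism \<phi> lets one computation serve for the polynomials themselves, for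
  their values at a point and for their images in the field of rational functions.\<close>

lemma sum_K_row:
  fixes \<phi> :: "'a poly \<Rightarrow> 'b::comm_ring_1" and w :: "nat \<Rightarrow> nat \<Rightarrow> 'b"
  assumes "comm_ring_hom \<phi>" and i: "1 \<le> i" "i < N" and a: "a < bs i"
  shows "(\<Sum>j=0..<N. \<Sum>l<bs j. \<phi> (Kb i j $$ (a,l)) * w j l) =
    \<phi> (g i) * w i a -
    (if i = p + 1 then \<phi> (h p) * (\<Sum>l<m. \<phi> [:U $$ (l,a):] * w p l)
     else \<phi> (h (i - 1)) * w (i - 1) a)" (is "_ = ?R - ?T")
proof -
  interpret comm_ring_hom \<phi> by fact
  have "(\<Sum>l<bs j. \<phi> (Kb i j $$ (a,l)) * w j l) =
    (if j = i then ?R else 0) - (if j = i - 1 then ?T else 0)" for j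
  proof -
    consider "j = i" | "j + 1 = i" | "j \<noteq> i" "j + 1 \<noteq> i" by blast
    then show ?thesis
    proof cases
      case 1
      have "(\<Sum>l<bs j. \<phi> (Kb i j $$ (a,l)) * w j l) = (\<Sum>l<bs i. if l = a then ?R else 0)"
        using 1 a by (intro sum.cong) (auto simp: K_block_def)
      then show ?thesis using 1 i a by simp
    next
      case 2
      show ?thesis
      proof (cases "i = p + 1")
        case True
        have "(\<Sum>l<bs j. \<phi> (Kb i j $$ (a,l)) * w j l) =
          (\<Sum>l<m. - (\<phi> (h p) * (\<phi> [:U $$ (l,a):] * w p l)))"
          using 2 a True U_carrier
          by (intro sum.cong) (auto simp: K_block_def block_size_def hom_distribs ac_simps
              simp del: mult_pCons_right)
        then show ?thesis using 2 i True by (simp add: sum_negf sum_distrib_left)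
      next
        case False
        then have bs: "bs j = bs i" using 2 by (auto simp: block_size_def)
        have "(\<Sum>l<bs j. \<phi> (Kb i j $$ (a,l)) * w j l) = (\<Sum>l<bs i. if l = a then - ?T else 0)"
          using 2 a False bs i by (intro sum.cong) (auto simp: K_block_def hom_distribs)
        then show ?thesis using 2 i a by simp
      qed
    next
      case 3
      have "(\<Sum>l<bs j. \<phi> (Kb i j $$ (a,l)) * w j l) = 0"
        using 3 a by (intro sum.neutral) (auto simp: K_block_def)
      then show ?thesis using 3 i by auto
    qed
  qed
  moreover have "i - 1 < N" using i by simp
  ultimately show ?thesis using i by (simp add: sum_subtractf)
qed

text \<open>Column \<open>j\<close> meets the two diagonals in rows \<open>j\<close> and
  \<open>j + 1\<close>. The two conditions account for the ends: rows start at 1, so column 0 has no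
  \<open>g\<close> block, and they stop at \<open>N - 1\<close>, so the last column has no
  \<open>h\<close> block.\<close>

lemma sum_K_col:
  fixes \<phi> :: "'a poly \<Rightarrow> 'b::comm_ring_1" and y :: "nat \<Rightarrow> nat \<Rightarrow> 'b"
  assumes "comm_ring_hom \<phi>" and j: "j < N" and l: "l < bs j"
  shows "(\<Sum>i=1..<N. \<Sum>b<bs i. \<phi> (Kb i j $$ (b,l)) * y i b) =
    (if 1 \<le> j then \<phi> (g j) * y j l else 0) -
    (if j + 1 < N then
       if j = p then \<phi> (h p) * (\<Sum>b<r. \<phi> [:U $$ (l,b):] * y (p + 1) b)
       else \<phi> (h j) * y (j + 1) l
     else 0)" (is "_ = (if _ then ?R else 0) - (if _ then ?T else 0)")
proof -
  interpret comm_ring_hom \<phi> by fact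
  have "(\<Sum>b<bs i. \<phi> (Kb i j $$ (b,l)) * y i b) =
    (if i = j then ?R else 0) - (if i = j + 1 then ?T else 0)" for i
  proof -
    consider "i = j" | "i = j + 1" | "i \<noteq> j" "i \<noteq> j + 1" by blast
    then show ?thesis
    proof cases
      case 1
      have "(\<Sum>b<bs i. \<phi> (Kb i j $$ (b,l)) * y i b) = (\<Sum>b<bs j. if b = l then ?R else 0)"
        using 1 l by (intro sum.cong) (auto simp: K_block_def)
      then show ?thesis using 1 l by simp
    next
      case 2
      show ?thesis
      proof (cases "j = p")
        case True
        have "(\<Sum>b<bs i. \<phi> (Kb i j $$ (b,l)) * y i b) =
          (\<Sum>b<r. - (\<phi> (h p) * (\<phi> [:U $$ (l,b):] * y (p + 1) b)))"
          using 2 l True U_carrier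
          by (intro sum.cong) (auto simp: K_block_def block_size_def hom_distribs ac_simps
              simp del: mult_pCons_right)
        then show ?thesis using 2 True by (simp add: sum_negf sum_distrib_left)
      next
        case False
        then have bs: "bs i = bs j" using 2 by (auto simp: block_size_def)
        have "(\<Sum>b<bs i. \<phi> (Kb i j $$ (b,l)) * y i b) = (\<Sum>b<bs j. if b = l then - ?T else 0)"
          using 2 l False bs by (intro sum.cong) (auto simp: K_block_def hom_distribs)
        then show ?thesis using 2 l by simp
      qed
    next
      case 3
      have "(\<Sum>b<bs i. \<phi> (Kb i j $$ (b,l)) * y i b) = 0"
        using 3 l by (intro sum.neutral) (auto simp: K_block_def)
      then show ?thesis using 3 by auto
    qed
  qed
  then show ?thesis using j by (simp add: sum_subtractf)
qed

text \<open>The last block of \<open>M\<close> contains both \<open>L (N - 1)\<close> and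
  \<open>L N\<close>. Its first summand joins the common factor \<open>gN\<close>, and the second
  becomes the separate term with \<open>hN\<close>.\<close>

lemma sum_M_row:
  fixes \<phi> :: "'a poly \<Rightarrow> 'b::comm_ring_1" and w :: "nat \<Rightarrow> nat \<Rightarrow> 'b"
  assumes "comm_ring_hom \<phi>" and a: "a < m"
  shows "(\<Sum>j=0..<N. \<Sum>l<bs j. \<phi> (Mb j $$ (a,l)) * w j l) =
    \<phi> gN * ((\<Sum>j=0..p. \<Sum>l<m. \<phi> [:D j $$ (a,l):] * w j l) +
             (\<Sum>j=p+1..N-1. \<Sum>l<r. \<phi> [:L j $$ (a,l):] * w j l)) +
    \<phi> hN * (\<Sum>l<r. \<phi> [:L N $$ (a,l):] * w (N - 1) l)"
proof -
  interpret comm_ring_hom \<phi> by fact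
  have D: "(\<Sum>l<bs j. \<phi> (Mb j $$ (a,l)) * w j l) =
      \<phi> gN * (\<Sum>l<m. \<phi> [:D j $$ (a,l):] * w j l)" if "j \<in> {0..p}" for j
  proof -
    have "D j \<in> carrier_mat m m" using D_carrier that by simp
    then show ?thesis unfolding sum_distrib_left using that a
      by (intro sum.cong) (auto simp: M_block_def block_size_def Let_def hom_mult mult.assoc
          simp del: mult_pCons_right mult_smult_left)
  qed
  have L: "(\<Sum>l<bs j. \<phi> (Mb j $$ (a,l)) * w j l) =
      \<phi> gN * (\<Sum>l<r. \<phi> [:L j $$ (a,l):] * w j l) +
      (if j = N - 1 then \<phi> hN * (\<Sum>l<r. \<phi> [:L N $$ (a,l):] * w (N - 1) l) else 0)"
    if j: "j \<in> {p+1..N-1}" for j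
  proof (cases "j = N - 1")
    case True
    have "L (N - 1) \<in> carrier_mat m r" "L N \<in> carrier_mat m r" using L_carrier N_ge by auto
    moreover have "\<not> N - 1 \<le> p" using N_ge by simp
    ultimately have "(\<Sum>l<bs j. \<phi> (Mb j $$ (a,l)) * w j l) =
      (\<Sum>l<r. \<phi> gN * (\<phi> [:L j $$ (a,l):] * w j l) +
             \<phi> hN * (\<phi> [:L N $$ (a,l):] * w (N - 1) l))"
      using True a
      by (intro sum.cong) (auto simp: M_block_def block_size_def Let_def hom_mult hom_add
          mult.assoc distrib_right simp del: mult_pCons_right mult_smult_left)
    then show ?thesis using True by (simp add: sum.distrib sum_distrib_left)
  next
    case False
    have "L j \<in> carrier_mat m r" using L_carrier j by auto
    then have "(\<Sum>l<bs j. \<phi> (Mb j $$ (a,l)) * w j l) =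
      (\<Sum>l<r. \<phi> gN * (\<phi> [:L j $$ (a,l):] * w j l))"
      using False a j
      by (intro sum.cong) (auto simp: M_block_def block_size_def Let_def hom_mult mult.assoc
          simp del: mult_pCons_right mult_smult_left)
    then show ?thesis using False by (simp add: sum_distrib_left)
  qed
  have "{0..<N} = {0..p} \<union> {p+1..N-1}" using N_ge by auto
  then have "(\<Sum>j=0..<N. \<Sum>l<bs j. \<phi> (Mb j $$ (a,l)) * w j l) =
      (\<Sum>j=0..p. \<Sum>l<bs j. \<phi> (Mb j $$ (a,l)) * w j l) +
      (\<Sum>j=p+1..N-1. \<Sum>l<bs j. \<phi> (Mb j $$ (a,l)) * w j l)"
    by (simp add: sum.union_disjoint)
  moreover have "N - 1 \<in> {p+1..N-1}" using N_ge by auto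
  ultimately show ?thesis
    by (simp add: D L sum.distrib sum_distrib_left[symmetric] distrib_left add.assoc
        del: Suc_eq_plus1 One_nat_def)
qed

end

section \<open>Kernels of the lower block rows\<close>

lemma comm_ring_hom_poly: "comm_ring_hom (\<lambda>f :: 'a::comm_ring_1 poly. poly f x)"
  by unfold_locales simp_all

text \<open>Only the \<open>H j\<close> are divided by, so the formula remains valid where some of
  the \<open>G j\<close> vanish, which is the situation at a pole.\<close>

lemma recurrence_backward:
  fixes G H w :: "nat \<Rightarrow> 'b::field"
  assumes "\<And>j. a \<le> j \<Longrightarrow> j < b \<Longrightarrow> H j \<noteq> 0 \<and> G (j + 1) * w (j + 1) = H j * w j"
    and "a \<le> j" "j \<le> b"
  shows "w j = (\<Prod>k=j+1..b. G k / H (k - 1)) * w b"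
  using assms(3,2)
proof (induction rule: inc_induct)
  case base
  show ?case by simp
next
  case (step j)
  have *: "H j \<noteq> 0" "G (j + 1) * w (j + 1) = H j * w j"
    using assms(1)[of j] step by simp_all
  then have "w j = G (j + 1) / H j * w (j + 1)" by (simp add: field_simps)
  also have "\<dots> = G (j + 1) / H j * ((\<Prod>k=j+1+1..b. G k / H (k - 1)) * w b)"
    using step by simp
  also have "\<dots> = (\<Prod>k=j+1..b. G k / H (k - 1)) * w b"
    using step.hyps by (subst (2) prod.atLeast_Suc_atMost) simp_all
  finally show ?case .
qed

text \<open>The product telescopes: the denominator \<open>H i\<close> cancels against
  \<open>G (i + 1) * w (i + 1) = H i * w i\<close>. It relates the two ends without dividing by any
  \<open>G i\<close>, and its coefficients are those in the lower two block rows of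
  \<open>R\<close>.\<close>

lemma recurrence_forward:
  fixes G H w :: "nat \<Rightarrow> 'b::field"
  assumes "\<And>j. a \<le> j \<Longrightarrow> j < b \<Longrightarrow> H j \<noteq> 0 \<and> G (j + 1) * w (j + 1) = H j * w j"
    and "a \<le> b"
  shows "(\<Prod>i=a..<b. G i / H i) * (G b * w b) = G a * w a"
  using assms(2,1)
proof (induction rule: dec_induct)
  case base
  show ?case by simp
next
  case (step b)
  have *: "H b \<noteq> 0" "G (b + 1) * w (b + 1) = H b * w b"
    using step.prems[of b] step.hyps by simp_all
  have "(\<Prod>i=a..<Suc b. G i / H i) * (G (Suc b) * w (Suc b)) =
      (\<Prod>i=a..<b. G i / H i) * (G b / H b) * (H b * w b)"
    using *(2) step.hyps by simp
  also have "\<dots> = (\<Prod>i=a..<b. G i / H i) * (G b * w b)"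
    using *(1) by simp
  also have "\<dots> = G a * w a" using step.prems by (intro step.IH) auto
  finally show ?case .
qed

section \<open>Zeros of the scalars \<open>g i\<close> and \<open>h j\<close>, and the kernels of
  \<open>K\<close>\<close>

context low_rank_pencil
begin

lemma poly_g_eq_0_iff: "1 \<le> i \<Longrightarrow> i \<le> N \<Longrightarrow> poly (g i) x = 0 \<longleftrightarrow> \<xi> i = Some x"
  using \<xi>_nonzero[of i] \<beta>_nonzero[of i]
  by (auto simp: g_poly_def split: option.splits)

lemma g_nonzero: "1 \<le> i \<Longrightarrow> i \<le> N \<Longrightarrow> g i \<noteq> 0"
  using \<beta>_nonzero[of i] by (auto simp: g_poly_def split: option.splits)

lemma poly_h: "poly (h j) x = x - \<sigma> j"
  by (simp add: h_poly_def)

text \<open>A common zero \<open>x\<close> would be both the pole \<xi> \<open>i\<close> and the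
  node \<sigma> \<open>j\<close>.\<close>

lemma poly_g_nonzero_or_poly_h_nonzero:
  "1 \<le> i \<Longrightarrow> i \<le> N \<Longrightarrow> j < N \<Longrightarrow> poly (g i) x \<noteq> 0 \<or> poly (h j) x \<noteq> 0"
  using poly_g_eq_0_iff[of i x] \<xi>_ne_\<sigma>[of i j] by (auto simp: poly_h)

text \<open>Forward substitution: once block \<open>j\<close> vanishes, the next row reduces to
  \<open>g (j + 1)\<close> times block \<open>j + 1\<close>, and this scalar can be cancelled. Since
  only cancellation is involved, an integral domain suffices and the lemma applies to polynomial
  vectors as well as to vectors over the field.\<close>

lemma K_kernel_zero:
  fixes \<phi> :: "'a poly \<Rightarrow> 'b::idom" and w :: "nat \<Rightarrow> nat \<Rightarrow> 'b"
  assumes \<phi>: "comm_ring_hom \<phi>" and g: "\<And>i. 1 \<le> i \<Longrightarrow> i < N \<Longrightarrow> \<phi> (g i) \<noteq> 0"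
    and w: "\<And>i a. 1 \<le> i \<Longrightarrow> i < N \<Longrightarrow> a < bs i \<Longrightarrow>
      (\<Sum>j=0..<N. \<Sum>l<bs j. \<phi> (Kb i j $$ (a,l)) * w j l) = 0"
    and w0: "\<And>l. l < m \<Longrightarrow> w 0 l = 0"
    and "j < N" "l < bs j"
  shows "w j l = 0"
  using assms(5,6)
proof (induction j arbitrary: l)
  case 0
  then show ?case using w0 by (simp add: block_size_def)
next
  case (Suc j)
  have "\<phi> (g (Suc j)) * w (Suc j) l = 0"
    using w[of "Suc j" l] sum_K_row[OF \<phi>, of "Suc j" l w] Suc
    by (auto simp: block_size_def split: if_splits)
  then show ?case using g[of "Suc j"] Suc.prems by simp
qed

text \<open>Coordinate form of the full column rank of \<open>U\<close>, through which the left
  kernel equations pass from blocks of size \<open>m\<close> to blocks of size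
  \<open>r\<close>.\<close>

lemma U_kernel:
  assumes "\<And>l. l < m \<Longrightarrow> (\<Sum>b<r. U $$ (l,b) * y b) = 0" "b < r"
  shows "y b = 0"
proof -
  have "U *\<^sub>v vec r y = 0\<^sub>v m"
    using U_carrier assms(1) by (intro eq_vecI) (auto simp: scalar_prod_def lessThan_atLeast0)
  then have "vec r y = 0\<^sub>v r"
    using mat_rank_eq_dim_col_iff[OF U_carrier] U_rank vec_carrier by blast
  then have "vec r y $ b = 0\<^sub>v r $ b" by simp
  then show ?thesis using assms(2) by simp
qed

text \<open>If no \<open>h j\<close> vanishes at \<open>x\<close> the equations are solved from the top, otherwise no
  \<open>g i\<close> vanishes and they are solved from the bottom.\<close>

lemma K_left_kernel_zero:
  assumes y: "\<And>j l. j < N \<Longrightarrow> l < bs j \<Longrightarrow>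
      (\<Sum>i=1..<N. \<Sum>b<bs i. poly (Kb i j $$ (b,l)) x * y i b) = 0"
    and "1 \<le> i" "i < N" "b < bs i"
  shows "y i b = 0"
proof -
  note col = sum_K_col[OF comm_ring_hom_poly[of x], where y = y]
  show ?thesis
  \<comment> \<open>The bound is \<open>N - 1\<close> because \<open>K\<close> contains only
    \<open>h 0\<close> to \<open>h (N - 2)\<close>; the factor \<open>h (N - 1)\<close> belongs to
    \<open>M\<close>.\<close>
  proof (cases "\<exists>j<N-1. poly (h j) x = 0")
    case False
    then have h: "poly (h j) x \<noteq> 0" if "j < N - 1" for j using that by blast
    show ?thesis using assms(2-4)
    proof (induction i arbitrary: b rule: nat_induct_at_least)
      \<comment> \<open>Column 0 consists of the single block \<open>- h 0\<close> in row 1, so it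
        gives \<open>y 1 = 0\<close> at once.\<close>
      case base
      then show ?case
        using y[of 0 b] col[of 0 b] h[of 0] p_ge N_ge by (simp add: block_size_def)
    next
      case (Suc i)
      show ?case
      proof (cases "i = p")
        case True
        \<comment> \<open>Column \<open>p\<close> reads
          \<open>g p * y p = h p * U y (p + 1)\<close>. Here \<open>y p\<close> vanishes by
          induction and \<open>h p\<close> is nonzero at \<open>x\<close>, so \<open>U\<close>
          annihilates the next block.\<close>
        have "(\<Sum>b<r. U $$ (l,b) * y (p + 1) b) = 0" if l: "l < m" for l
          using y[of p l] col[of p l] h[of p] l Suc.IH[of l] Suc True p_ge N_ge
          by (simp add: block_size_def)
        then show ?thesis using U_kernel[of "y (p + 1)" b] True Suc.prems
          by (simp add: block_size_def)
      next
        case False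
        then have "bs i = bs (Suc i)" by (simp add: block_size_def)
        then show ?thesis
          using y[of i b] col[of i b] h[of i] Suc False by simp
      qed
    qed
  next
    case True
    \<comment> \<open>Now \<open>x\<close> is one of the nodes \<sigma> \<open>j\<close>, and no
      pole equals a node. The descent starts from column \<open>N - 1\<close>, whose only block is
      \<open>g (N - 1)\<close>.\<close>
    then have g: "poly (g i) x \<noteq> 0" if "1 \<le> i" "i < N" for i
      using poly_g_nonzero_or_poly_h_nonzero[of i] that by fastforce
    have "i \<le> N - 1" using assms(3) by simp
    then show ?thesis using assms(2,4)
    proof (induction i arbitrary: b rule: inc_induct)
      case base
      then show ?case using y[of "N - 1" b] col[of "N - 1" b] g[of "N - 1"] N_ge by simp
    next
      case (step i)
      have IH: "y (Suc i) b' = 0" if "b' < bs (Suc i)" for b'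
        using step that by simp
      have iN: "i < N" "i + 1 < N" using step.hyps by simp_all
      have zero: "(if i = p then poly (h p) x * (\<Sum>b'<r. poly [:U $$ (b,b'):] x * y (p + 1) b')
          else poly (h i) x * y (i + 1) b) = 0"
        using IH step.prems by (auto simp: block_size_def intro!: sum.neutral split: if_splits)
      have "poly (g i) x * y i b = 0"
        using y[OF iN(1) step.prems(2)] unfolding col[OF iN(1) step.prems(2)] zero
        using step.prems(1) by simp
      then show ?case using g[OF step.prems(1) iN(1)] by simp
    qed
  qed
qed

end

section \<open>The kernel at a pole\<close>

context low_rank_pencil
begin

abbreviation "R \<equiv> R_mat m r p N \<sigma> \<beta> \<xi> D L U"
abbreviation "R1 \<equiv> R1_mat m p N \<sigma> \<beta> \<xi> D"
abbreviation "R2 \<equiv> R2_mat m r p N \<sigma> \<beta> \<xi> L"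

lemma R_carrier: "R \<in> carrier_mat (m + (m + r)) (m + r)"
  unfolding R_mat_def using U_carrier
  by (intro carrier_append_rows append_cols_carrier) (simp_all add: R1_mat_def R2_mat_def)

lemma R_index:
  assumes c: "c < m + r"
  shows R_index_top: "a < m \<Longrightarrow> R $$ (a,c) = (if c < m then R1 $$ (a,c) else R2 $$ (a, c - m))"
    and R_index_middle: "a < m \<Longrightarrow> R $$ (m + a, c) =
      (if c = a then (\<Prod>i=1..p-1. to_fract (g i) / to_fract (h i)) * to_fract (g p) else 0)"
    and R_index_bottom: "b < r \<Longrightarrow> R $$ (m + (m + b), c) =
      (if c < m then - to_fract (h p) * const_ratfun (U $$ (c,b))
       else if c = m + b then
         (\<Prod>i=p+1..N-2. to_fract (g i) / to_fract (h i)) * to_fract (g (N - 1))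
       else 0)"
proof -
  define X where "X = ((\<Prod>i=1..p-1. to_fract (g i) / to_fract (h i)) * to_fract (g p)) \<cdot>\<^sub>m 1\<^sub>m m"
  define Y where "Y = - to_fract (h p) \<cdot>\<^sub>m map_mat const_ratfun (U\<^sup>T)"
  define Z where "Z = (0\<^sub>m m r :: 'a ratfun mat)"
  define W where "W = ((\<Prod>i=p+1..N-2. to_fract (g i) / to_fract (h i)) * to_fract (g (N - 1))) \<cdot>\<^sub>m 1\<^sub>m r"
  have R1: "R1 \<in> carrier_mat m m" and R2: "R2 \<in> carrier_mat m r"
    and X: "X \<in> carrier_mat m m" and Z: "Z \<in> carrier_mat m r"
    and Y: "Y \<in> carrier_mat r m" and W: "W \<in> carrier_mat r r"
    using U_carrier by (simp_all add: R1_mat_def R2_mat_def X_def Y_def Z_def W_def)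
  note top = append_cols_carrier[OF R1 R2] and mid = append_cols_carrier[OF X Z]
    and bot = append_cols_carrier[OF Y W]
  have R: "R = (R1 @\<^sub>c R2) @\<^sub>r (X @\<^sub>c Z) @\<^sub>r (Y @\<^sub>c W)"
    by (simp add: R_mat_def X_def Y_def Z_def W_def)
  note rows = append_rows_index[OF top carrier_append_rows[OF mid bot] _ c, folded R]
    append_rows_index[OF mid bot _ c]
  show "R $$ (a,c) = (if c < m then R1 $$ (a,c) else R2 $$ (a, c - m))" if "a < m"
    using rows(1)[of a] that append_cols_index[OF R1 R2 that c] by simp
  show "R $$ (m + a, c) =
      (if c = a then (\<Prod>i=1..p-1. to_fract (g i) / to_fract (h i)) * to_fract (g p) else 0)"
    if "a < m"
    using rows(1)[of "m + a"] rows(2)[of a] append_cols_index[OF X Z that c] that c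
    by (simp add: X_def Z_def)
  show "R $$ (m + (m + b), c) =
      (if c < m then - to_fract (h p) * const_ratfun (U $$ (c,b))
       else if c = m + b then
         (\<Prod>i=p+1..N-2. to_fract (g i) / to_fract (h i)) * to_fract (g (N - 1))
       else 0)" if "b < r"
    using rows(1)[of "m + (m + b)"] rows(2)[of "m + b"] append_cols_index[OF Y W that c]
      that c U_carrier
    by (auto simp: Y_def W_def)
qed

text \<open>At a pole \<open>x\<close> the kernel equations of the last block columns of the pencil express all blocks
  of \<open>w\<close> through \<open>w p\<close> and \<open>w (N - 1)\<close>, and the equations that remain form the kernel of \<open>R\<close>.\<close>

lemma right_kernel_zero:
  assumes R: "\<And>z. z \<in> finite_poles \<xi> (N - 1) \<Longrightarrow> mat_rank (ratfun_mat_eval R z) = m + r"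
    and K: "\<And>i a. 1 \<le> i \<Longrightarrow> i < N \<Longrightarrow> a < bs i \<Longrightarrow>
      (\<Sum>j=0..<N. \<Sum>l<bs j. poly (Kb i j $$ (a,l)) x * w j l) = 0"
    and M: "\<And>a. a < m \<Longrightarrow> (\<Sum>j=0..<N. \<Sum>l<bs j. poly (Mb j $$ (a,l)) x * w j l) = 0"
    and w0: "\<And>l. l < m \<Longrightarrow> w 0 l = 0"
    and jl: "j < N" "l < bs j"
  shows "w j l = 0"
\<comment> \<open>If no \<open>g i\<close> with \<open>i < N\<close> vanishes at \<open>x\<close>,
  forward substitution from \<open>w 0 = 0\<close> suffices. Otherwise \<open>x\<close> is a finite
  pole and the rank of \<open>R\<close> comes into play.\<close>
proof (cases "\<exists>i. 1 \<le> i \<and> i < N \<and> poly (g i) x = 0")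
  case False
  then have "poly (g i) x \<noteq> 0" if "1 \<le> i" "i < N" for i using that by blast
  then show ?thesis by (rule K_kernel_zero[OF comm_ring_hom_poly _ K w0 jl])
next
  case True
  then obtain k where k: "1 \<le> k" "k < N" "poly (g k) x = 0" by blast
  define G where "G i = poly (g i) x" for i
  define H where "H j = poly (h j) x" for j
  \<comment> \<open>As \<open>x\<close> is the pole \<xi> \<open>k\<close>, it differs from every
    node. The range includes \<open>N - 1\<close>, so division by \<open>h (N - 1)\<close> in the
    equation from \<open>M\<close> is covered too.\<close>
  have H: "H j \<noteq> 0" if "j < N" for j
    using poly_g_nonzero_or_poly_h_nonzero[of k j x] k that by (simp add: H_def)
  have "x \<in> finite_poles \<xi> (N - 1)"
    using k poly_g_eq_0_iff[of k x] by (auto simp: finite_poles_def)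
  note rank = R[OF this]
  note row = sum_K_row[OF comm_ring_hom_poly[of x], where w = w, folded G_def H_def]
  have step: "H j \<noteq> 0 \<and> G (j + 1) * w (j + 1) a = H j * w j a"
    if "1 \<le> j" "j + 1 < N" "j \<noteq> p" "a < bs (j + 1)" for j a
    using K[of "j + 1" a] row[of "j + 1" a] H[of j] that by simp
  have top: "G 1 * w 1 a = 0" if "a < m" for a
    using K[of 1 a] row[of 1 a] w0[OF that] that p_ge N_ge by (simp add: block_size_def)
  have mid: "G (p + 1) * w (p + 1) b = H p * (\<Sum>l<m. U $$ (l,b) * w p l)" if "b < r" for b
    using K[of "p + 1" b] row[of "p + 1" b] that N_ge by (simp add: block_size_def)
  \<comment> \<open>\<open>P\<close> and \<open>Q\<close> are the coefficients of backward
    substitution from \<open>w p\<close> and from \<open>w (N - 1)\<close>. Two chains are required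
    because \<open>U\<close> interrupts the recurrence between rows \<open>p\<close> and
    \<open>p + 2\<close>.\<close>
  define P where "P j = (\<Prod>k=j+1..p. G k / H (k - 1))" for j
  define Q where "Q j = (\<Prod>k=j+1..N-1. G k / H (k - 1))" for j
  have w_upper: "w j a = P j * w p a" if "1 \<le> j" "j \<le> p" "a < m" for j a
    unfolding P_def using that N_ge
    by (intro recurrence_backward[where a = 1 and w = "\<lambda>j. w j a"] step) (auto simp: block_size_def)
  have w_lower: "w j b = Q j * w (N - 1) b" if "p + 1 \<le> j" "j \<le> N - 1" "b < r" for j b
    unfolding Q_def using that
    by (intro recurrence_backward[where a = "p + 1" and w = "\<lambda>j. w j b"] step)
      (auto simp: block_size_def)
  define E where "E = ratfun_mat_eval R x"
  have E: "E \<in> carrier_mat (m + (m + r)) (m + r)"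
    using R_carrier by (simp add: E_def ratfun_mat_eval_def)
  have E_index: "E $$ (i,c) = ratfun_eval (R $$ (i,c)) x" if "i < m + (m + r)" "c < m + r" for i c
    using R_carrier that by (simp add: E_def ratfun_mat_eval_def)
  have frac: "ratfun_defined_at (to_fract (g i) / to_fract (h j)) x"
      "ratfun_eval (to_fract (g i) / to_fract (h j)) x = G i / H j" if "j < N" for i j
    using ratfun_to_fract_divide[of "h j" x "g i"] H[OF that] by (simp_all add: G_def H_def)
  have prod_frac: "ratfun_defined_at (\<Prod>k=a..b. to_fract (g k) / to_fract (h (f k))) x"
      "ratfun_eval (\<Prod>k=a..b. to_fract (g k) / to_fract (h (f k))) x = (\<Prod>k=a..b. G k / H (f k))"
    if "\<And>k. a \<le> k \<Longrightarrow> k \<le> b \<Longrightarrow> f k < N" for a b f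
    using ratfun_prod[of "{a..b}" "\<lambda>k. to_fract (g k) / to_fract (h (f k))" x] that
    by (auto simp: frac)
  have E1: "E $$ (a,c) = G N / H (N - 1) *
      ((\<Sum>j=1..p-1. P j * D j $$ (a,c)) + D p $$ (a,c))" if "a < m" "c < m" for a c
  proof -
    let ?t = "\<lambda>j. (\<Prod>k=j+1..p. to_fract (g k) / to_fract (h (k - 1))) * const_ratfun (D j $$ (a,c))"
    have t: "ratfun_defined_at (?t j) x" "ratfun_eval (?t j) x = P j * D j $$ (a,c)" for j
      using prod_frac[of "j + 1" p "\<lambda>k. k - 1"] N_ge
      by (simp_all add: ratfun_mult ratfun_const P_def less_imp_diff_less)
    show ?thesis
      using that ratfun_sum[of "{1..p-1}" ?t x] t frac[of "N - 1" N] N_ge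
      by (simp add: E_index R_index_top R1_mat_def ratfun_mult ratfun_add ratfun_const
          del: times_divide_eq_left)
  qed
  have E2: "E $$ (a, m + c) = G N / H (N - 1) *
      (\<Sum>j=p+1..N-1. Q j * L j $$ (a,c)) + L N $$ (a,c)" if "a < m" "c < r" for a c
  proof -
    let ?t = "\<lambda>j. (\<Prod>k=j+1..N. to_fract (g k) / to_fract (h (k - 1))) * const_ratfun (L j $$ (a,c))"
    have t: "ratfun_defined_at (?t j) x"
      "ratfun_eval (?t j) x = G N / H (N - 1) * (Q j * L j $$ (a,c))" if "j \<in> {p+1..N-1}" for j
    proof -
      \<comment> \<open>The factor for \<open>k = N\<close> is the same for all \<open>j\<close>.
        Splitting it off leaves \<open>Q j\<close>, whose product stops at
        \<open>N - 1\<close>.\<close>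
      have "{j+1..N} = insert N {j+1..N-1}" using that N_ge by auto
      moreover have "N \<notin> {j+1..N-1}" using that by auto
      ultimately have "(\<Prod>k=j+1..N. G k / H (k - 1)) = G N / H (N - 1) * Q j"
        unfolding Q_def by simp
      then show "ratfun_defined_at (?t j) x"
        "ratfun_eval (?t j) x = G N / H (N - 1) * (Q j * L j $$ (a,c))"
        using prod_frac[of "j + 1" N "\<lambda>k. k - 1"] that
        by (simp_all add: ratfun_mult ratfun_const)
    qed
    show ?thesis
      using that ratfun_sum[of "{p+1..N-1}" ?t x] t
      by (simp add: E_index R_index_top R2_mat_def ratfun_add ratfun_const sum_distrib_left)
  qed
  have E3: "E $$ (m + a, c) = (if c = a then (\<Prod>i=1..p-1. G i / H i) * G p else 0)"
    if "a < m" "c < m + r" for a c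
    using that prod_frac[of 1 "p - 1" "\<lambda>k. k"] N_ge ratfun_to_fract[of _ x]
      ratfun_to_fract[of 0 x]
    by (simp add: E_index R_index_middle ratfun_mult G_def)
  have E4: "E $$ (m + (m + b), c) = - H p * U $$ (c,b)" if "b < r" "c < m" for b c
    using that ratfun_to_fract[of "- h p" x] ratfun_const[of _ x]
      ratfun_mult[of "to_fract (- h p)" x "const_ratfun (U $$ (c,b))"]
    by (simp add: E_index R_index_bottom H_def)
  have E5: "E $$ (m + (m + b), m + c) = (if c = b then (\<Prod>i=p+1..N-2. G i / H i) * G (N - 1) else 0)"
    if "b < r" "c < r" for b c
    using that prod_frac[of "p + 1" "N - 2" "\<lambda>k. k"] ratfun_to_fract[of _ x]
      ratfun_to_fract[of 0 x]
    by (simp add: E_index R_index_bottom ratfun_mult G_def)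
  \<comment> \<open>After backward substitution only the blocks \<open>p\<close> and
    \<open>N - 1\<close> of \<open>w\<close> remain free. They form the vector on which
    \<open>E\<close>, the value of \<open>R\<close> at \<open>x\<close>, acts.\<close>
  define z where "z = vec (m + r) (\<lambda>c. if c < m then w p c else w (N - 1) (c - m))"
  have Ez: "(E *\<^sub>v z) $ i = (\<Sum>c<m. E $$ (i,c) * w p c) + (\<Sum>c<r. E $$ (i, m + c) * w (N - 1) c)"
    if "i < m + (m + r)" for i
  proof -
    have "(E *\<^sub>v z) $ i = (\<Sum>c<m+r. E $$ (i,c) * z $ c)"
      using E that by (simp add: scalar_prod_def z_def lessThan_atLeast0)
    then show ?thesis by (simp add: sum_lessThan_add z_def)
  qed
  have "E *\<^sub>v z = 0\<^sub>v (m + (m + r))"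
  proof (rule eq_vecI)
    fix i assume "i < dim_vec (0\<^sub>v (m + (m + r)) :: 'a vec)"
    then consider "i < m" | a where "i = m + a" "a < m" | b where "i = m + (m + b)" "b < r"
      by (metis add_less_cancel_left index_zero_vec(2) le_Suc_ex linorder_not_less)
    then have "(E *\<^sub>v z) $ i = 0"
    proof cases
      case 1
      have D: "(\<Sum>j=0..p. \<Sum>l<m. D j $$ (i,l) * w j l) =
          (\<Sum>l<m. ((\<Sum>j=1..p-1. P j * D j $$ (i,l)) + D p $$ (i,l)) * w p l)"
      proof -
        \<comment> \<open>The term for 0 vanishes with \<open>w 0\<close>, and the term for
          \<open>p\<close> has the empty product as coefficient. This explains the range from 1 to
          \<open>p - 1\<close> and the isolated \<open>D p\<close> in \<open>R1\<close>.\<close>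
        have "{0..p} = insert 0 (insert p {1..p-1})" using p_ge by auto
        moreover have "0 \<notin> insert p {1..p-1}" "p \<notin> {1..p-1}" using p_ge by auto
        ultimately have "(\<Sum>j=0..p. \<Sum>l<m. D j $$ (i,l) * w j l) =
            (\<Sum>l<m. D p $$ (i,l) * w p l) + (\<Sum>j=1..p-1. \<Sum>l<m. D j $$ (i,l) * w j l)"
          using w0 by simp
        also have "(\<Sum>j=1..p-1. \<Sum>l<m. D j $$ (i,l) * w j l) =
            (\<Sum>j=1..p-1. \<Sum>l<m. P j * D j $$ (i,l) * w p l)"
        proof (intro sum.cong refl)
          fix j l assume "j \<in> {1..p-1}" "l \<in> {..<m}"
          then have "w j l = P j * w p l" using p_ge by (intro w_upper) auto
          then show "D j $$ (i,l) * w j l = P j * D j $$ (i,l) * w p l" by simp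
        qed
        also have "\<dots> = (\<Sum>l<m. (\<Sum>j=1..p-1. P j * D j $$ (i,l)) * w p l)"
          by (subst sum.swap) (simp add: sum_distrib_right)
        finally show ?thesis by (simp add: sum.distrib distrib_right add.commute)
      qed
      have L: "(\<Sum>j=p+1..N-1. \<Sum>l<r. L j $$ (i,l) * w j l) =
          (\<Sum>l<r. (\<Sum>j=p+1..N-1. Q j * L j $$ (i,l)) * w (N - 1) l)"
      proof -
        have "(\<Sum>j=p+1..N-1. \<Sum>l<r. L j $$ (i,l) * w j l) =
            (\<Sum>j=p+1..N-1. \<Sum>l<r. Q j * L j $$ (i,l) * w (N - 1) l)"
        proof (intro sum.cong refl)
          fix j l assume "j \<in> {p+1..N-1}" "l \<in> {..<r}"
          then have "w j l = Q j * w (N - 1) l" by (intro w_lower) auto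
          then show "L j $$ (i,l) * w j l = Q j * L j $$ (i,l) * w (N - 1) l" by simp
        qed
        also have "\<dots> = (\<Sum>l<r. (\<Sum>j=p+1..N-1. Q j * L j $$ (i,l)) * w (N - 1) l)"
          by (subst sum.swap) (simp add: sum_distrib_right)
        finally show ?thesis .
      qed
      let ?S = "(\<Sum>l<m. ((\<Sum>j=1..p-1. P j * D j $$ (i,l)) + D p $$ (i,l)) * w p l)"
      let ?T = "(\<Sum>l<r. (\<Sum>j=p+1..N-1. Q j * L j $$ (i,l)) * w (N - 1) l)"
      let ?V = "(\<Sum>l<r. L N $$ (i,l) * w (N - 1) l)"
      \<comment> \<open>This is the equation from \<open>M\<close> in terms of the two free blocks.
        Multiplied by \<open>\<beta> N\<close> and divided by \<open>H (N - 1)\<close>, it becomes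
        the first block row of \<open>E\<close>.\<close>
      have "1 / \<beta> N * G N * (?S + ?T) + 1 / \<beta> N * H (N - 1) * ?V = 0"
        using M[OF 1] sum_M_row[OF comm_ring_hom_poly[of x] 1, of w] D L
        by (simp add: G_def H_def)
      then have eq: "G N * (?S + ?T) + H (N - 1) * ?V = 0"
        using \<beta>_nonzero[of N] by (simp add: field_simps)
      have "(E *\<^sub>v z) $ i = G N / H (N - 1) * ?S + (G N / H (N - 1) * ?T + ?V)"
      proof -
        have "(\<Sum>c<m. E $$ (i,c) * w p c) = G N / H (N - 1) * ?S"
          unfolding sum_distrib_left[of "G N / H (N - 1)"]
          by (intro sum.cong refl) (simp only: E1[OF 1] lessThan_iff mult.assoc)
        moreover have "(\<Sum>c<r. E $$ (i, m + c) * w (N - 1) c) = G N / H (N - 1) * ?T + ?V"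
          unfolding sum_distrib_left[of "G N / H (N - 1)"] sum.distrib[symmetric]
          by (intro sum.cong refl) (simp only: E2[OF 1] lessThan_iff distrib_right mult.assoc)
        ultimately show ?thesis using Ez 1 by simp
      qed
      also have "\<dots> = (G N * (?S + ?T) + H (N - 1) * ?V) / H (N - 1)"
        using H[of "N - 1"] N_ge by (simp add: field_simps)
      finally show ?thesis unfolding eq by simp
    next
      case (2 a)
      \<comment> \<open>Telescoping carries the middle block row of \<open>E\<close> back to block
        1, where row 1 of \<open>K\<close> with \<open>w 0 = 0\<close> makes
        \<open>G 1 * w 1 a\<close> vanish.\<close>
      have "(\<Prod>i=1..p-1. G i / H i) * (G p * w p a) = G 1 * w 1 a"
        using recurrence_forward[of 1 p H G "\<lambda>j. w j a"] step[of _ a] 2 p_ge N_ge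
        by (cases p) (simp_all add: block_size_def atLeastLessThanSuc_atLeastAtMost)
      then have zero: "(\<Prod>i=1..p-1. G i / H i) * G p * w p a = 0"
        using top[OF 2(2)] by (simp add: mult.assoc)
      have "(E *\<^sub>v z) $ i = (\<Sum>c<m. E $$ (m + a, c) * w p c) +
          (\<Sum>c<r. E $$ (m + a, m + c) * w (N - 1) c)"
        unfolding 2(1) by (rule Ez) (use 2 in simp)
      also have "(\<Sum>c<r. E $$ (m + a, m + c) * w (N - 1) c) = 0"
        using 2 by (intro sum.neutral) (auto simp: E3)
      also have "(\<Sum>c<m. E $$ (m + a, c) * w p c) =
          (\<Sum>c<m. if c = a then (\<Prod>i=1..p-1. G i / H i) * G p * w p a else 0)"
        using 2 by (intro sum.cong) (auto simp: E3)
      finally show ?thesis using zero by simp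
    next
      case (3 b)
      have "{p+1..N-2} = {p+1..<N-1}" using N_ge by auto
      \<comment> \<open>The lower chain telescopes to \<open>G (p + 1) * w (p + 1) b\<close>. By
        \<open>mid\<close> this cancels the contribution of \<open>U\<close> in the last block row
        of \<open>E\<close>.\<close>
      then have eq: "(\<Prod>i=p+1..N-2. G i / H i) * (G (N - 1) * w (N - 1) b) = G (p + 1) * w (p + 1) b"
        using recurrence_forward[of "p + 1" "N - 1" H G "\<lambda>j. w j b"] step[of _ b] 3 N_ge
        by (simp add: block_size_def)
      have "(E *\<^sub>v z) $ i = (\<Sum>c<m. E $$ (m + (m + b), c) * w p c) +
          (\<Sum>c<r. E $$ (m + (m + b), m + c) * w (N - 1) c)"
        unfolding 3(1) by (rule Ez) (use 3 in simp)
      also have "(\<Sum>c<m. E $$ (m + (m + b), c) * w p c) = - H p * (\<Sum>c<m. U $$ (c,b) * w p c)"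
        unfolding sum_distrib_left using 3 by (intro sum.cong) (auto simp: E4)
      also have "(\<Sum>c<r. E $$ (m + (m + b), m + c) * w (N - 1) c) =
          (\<Sum>c<r. if c = b then (\<Prod>i=p+1..N-2. G i / H i) * (G (N - 1) * w (N - 1) b) else 0)"
        using 3 by (intro sum.cong) (auto simp: E5)
      finally show ?thesis using 3 mid[of b] eq by simp
    qed
    then show "(E *\<^sub>v z) $ i = 0\<^sub>v (m + (m + r)) $ i"
      using \<open>i < dim_vec (0\<^sub>v (m + (m + r)) :: 'a vec)\<close> by simp
  qed (use E in simp)
  moreover have "z \<in> carrier_vec (m + r)" by (simp add: z_def)
  ultimately have z: "z = 0\<^sub>v (m + r)"
    using mat_rank_eq_dim_col_iff[OF E] rank unfolding E_def by blast
  have wp: "w p a = 0" if "a < m" for a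
    using arg_cong[OF z, of "\<lambda>v. v $ a"] that by (simp add: z_def)
  have wN: "w (N - 1) b = 0" if "b < r" for b
    using arg_cong[OF z, of "\<lambda>v. v $ (m + b)"] that by (simp add: z_def)
  show ?thesis
  proof (cases "j \<le> p")
    case True
    then show ?thesis using w0[of l] w_upper[of j l] wp[of l] jl
      by (cases "j = 0") (simp_all add: block_size_def)
  next
    case False
    then show ?thesis using w_lower[of j l] wN[of l] jl by (simp add: block_size_def)
  qed
qed

end

section \<open>The transfer function\<close>

lemma comm_ring_hom_const_ratfun: "comm_ring_hom (const_ratfun :: 'a::field \<Rightarrow> 'a ratfun)"
  by unfold_locales (simp_all add: const_ratfun_def one_pCons[symmetric]
      flip: to_fract_add to_fract_mult to_fract_uminus)

lemma inj_comm_ring_hom_to_fract: "inj_comm_ring_hom (to_fract :: 'a::idom \<Rightarrow> 'a fract)"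
  by unfold_locales simp_all

lemma diag_id_0: "diag_id G 0 = G"
  by (rule eq_matI) (auto simp: diag_id_def)

lemma sum_mult_if_eq:
  fixes f :: "nat \<Rightarrow> 'b::comm_ring_1"
  assumes "c < k"
  shows "(\<Sum>l<k. f l * (if l = c then 1 else 0)) = f c"
proof -
  have "(\<Sum>l<k. f l * (if l = c then 1 else 0)) = (\<Sum>l<k. if l = c then f c else 0)"
    by (intro sum.cong) auto
  then show ?thesis using assms by simp
qed

context low_rank_pencil
begin

abbreviation "Q \<equiv> Q_mat m p N \<sigma> \<beta> \<xi> D L U"
abbreviation "b \<equiv> b_fun \<sigma> \<beta> \<xi>"
abbreviation "S \<equiv> L_pencil m r p N \<sigma> \<beta> \<xi> D L U"

definition "D_part = mat m m (\<lambda>(i,j). M $$ (i,j))"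
text \<open>The sign compensates the one in the block \<open>- C\<close> of a system matrix: the
  columns of \<open>M\<close> after the first \<open>m\<close> are \<open>- C_part\<close>.\<close>

definition "C_part = mat m n (\<lambda>(i,j). - M $$ (i, j + m))"
definition "B_part = mat n m (\<lambda>(i,j). K $$ (i,j))"

lemma sum_bs: "sum bs {0..<N} = m + n"
  using sum_bs_from_0[of N] N_ge by simp

lemma A_eq_K: "i < n \<Longrightarrow> j < n \<Longrightarrow> A $$ (i,j) = K $$ (i, j + m)"
  using K_carrier sum_bs by (simp add: A_mat_def)

lemma sum_row_blocks: "(\<Sum>k<n. f k) = (\<Sum>i=1..<N. \<Sum>a<bs i. f (sum bs {1..<i} + a))"
  using sum_blocks[of 1 N f bs] N_ge by simp

lemma sum_from_0: "(\<Sum>j=0..<N. \<Sum>l<bs j. f j l) = (\<Sum>l<m. f 0 l) + (\<Sum>j=1..<N. \<Sum>l<bs j. f j l)"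
  using N_ge by (simp add: sum.atLeast_Suc_lessThan block_size_def)

section \<open>The pencil as a linear system matrix\<close>

lemma pencil_eq: "S = four_block_mat D_part (- C_part) B_part A"
proof (rule eq_matI)
  note [simp] = D_part_def C_part_def B_part_def
  have dims: "dim_row A = n" "dim_col A = n" using A_carrier by simp_all
  have S: "S \<in> carrier_mat (m + n) (m + n)"
    unfolding L_pencil_def using M_carrier K_carrier sum_bs by simp
  then show "dim_row S = dim_row (four_block_mat D_part (- C_part) B_part A)"
    "dim_col S = dim_col (four_block_mat D_part (- C_part) B_part A)"
    by (simp_all add: dims)
  fix i j
  assume "i < dim_row (four_block_mat D_part (- C_part) B_part A)"
    "j < dim_col (four_block_mat D_part (- C_part) B_part A)"
  then have ij: "i < m + n" "j < m + n" by (simp_all add: dims)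
  then show "S $$ (i,j) = four_block_mat D_part (- C_part) B_part A $$ (i,j)"
    using append_rows_index[OF M_carrier K_carrier] sum_bs
    by (auto simp: L_pencil_def dims A_eq_K)
qed

lemma degree_g_le: "degree (g i) \<le> 1"
  unfolding g_poly_def by (rule order.trans[OF degree_smult_le]) (simp split: option.split)

lemma degree_h_le: "degree (h i) \<le> 1"
  by (simp add: h_poly_def)

lemma degree_mult_const_le: "degree f \<le> 1 \<Longrightarrow> degree (f * [:c:]) \<le> 1"
  using degree_mult_le[of f "[:c:]"] by simp

text \<open>Each entry of the pencil lies in a single block, and block entries are combinations of
  some \<open>g i\<close> and \<open>h j\<close> with constant coefficients.\<close>

lemma linear_pencil: "linear_poly_mat S"
  unfolding linear_poly_mat_def
proof (intro allI impI)
  have S: "S \<in> carrier_mat (m + n) (m + n)"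
    unfolding L_pencil_def using M_carrier K_carrier sum_bs by simp
  fix i j assume "i < dim_row S" "j < dim_col S"
  then have ij: "i < m + n" "j < sum bs {0..<N}" using S sum_bs by simp_all
  obtain j' l where j': "j' < N" "l < bs j'" "j = sum bs {0..<j'} + l"
    using block_index_cases[OF ij(2)] by metis
  show "degree (S $$ (i,j)) \<le> 1"
  proof (cases "i < m")
    case True
    then have "S $$ (i,j) = Mb j' $$ (i,l)"
      using append_rows_index[OF M_carrier K_carrier ij] M_index j' by (simp add: L_pencil_def)
    moreover have "degree (Mb j' $$ (i,l)) \<le> 1"
    proof -
      have gN: "degree (gN * [:c:]) \<le> 1" and hN: "degree (hN * [:c:]) \<le> 1" for c
        using degree_mult_const_le[OF degree_g_le] degree_mult_const_le[OF degree_h_le]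
        by (metis degree_smult_le mult_smult_left order_trans)+
      have "D j' \<in> carrier_mat m m" if "j' \<le> p" using D_carrier that .
      moreover have "L j' \<in> carrier_mat m r" if "\<not> j' \<le> p" using L_carrier that j' by simp
      moreover have "L (N - 1) \<in> carrier_mat m r" "L N \<in> carrier_mat m r"
        using L_carrier N_ge by simp_all
      ultimately show ?thesis
        using True j' gN hN
        by (auto simp: M_block_def block_size_def Let_def
            simp del: mult_pCons_right mult_smult_left intro!: degree_add_le)
    qed
    ultimately show ?thesis by simp
  next
    case False
    then have "i - m < n" using ij by simp
    then obtain i' a where i': "1 \<le> i'" "i' < N" "a < bs i'" "i - m = sum bs {1..<i'} + a"
      by (rule block_index_cases)
    have "S $$ (i,j) = Kb i' j' $$ (a,l)"
      using append_rows_index[OF M_carrier K_carrier ij] False K_index[OF i'(1-3) j'(1,2)] j' i'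
      by (simp add: L_pencil_def)
    moreover have "degree (Kb i' j' $$ (a,l)) \<le> 1"
    \<comment> \<open>A left neighbour of the diagonal other than the one in row
      \<open>p + 1\<close> is a multiple of the identity of size \<open>bs i'\<close>. The equality
      of the two block sizes puts the column index \<open>l\<close> within it.\<close>
    proof (cases "i' = j' + 1 \<and> i' \<noteq> p + 1")
      case True
      then have "bs i' = bs j'" by (auto simp: block_size_def)
      then show ?thesis using True i' j' degree_h_le[of j'] by (simp add: K_block_def)
    next
      case False
      then show ?thesis
        using i' j' U_carrier degree_g_le degree_h_le degree_mult_const_le[of "- h p"]
        by (auto simp: K_block_def block_size_def simp del: mult_pCons_right)
    qed
    ultimately show ?thesis by simp
  qed
qed

text \<open>A kernel vector of \<open>A\<close> over the polynomials, extended by a zero block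
  \<open>w 0\<close>, is annihilated by \<open>K\<close>. Forward substitution makes it zero because
  no \<open>g i\<close> is the zero polynomial.\<close>

lemma det_A_nonzero: "det A \<noteq> 0"
proof
  assume "det A = 0"
  then obtain v where v: "v \<in> carrier_vec n" "v \<noteq> 0\<^sub>v n" "A *\<^sub>v v = 0\<^sub>v n"
    using det_0_iff_vec_prod_zero[OF A_carrier] by blast
  define w where "w j l = (if j = 0 then 0 else v $ (sum bs {1..<j} + l))" for j l
  have id: "comm_ring_hom (\<lambda>f :: 'a poly. f)" by unfold_locales simp_all
  have K: "(\<Sum>j=0..<N. \<Sum>l<bs j. Kb i j $$ (a,l) * w j l) = 0"
    if i: "1 \<le> i" "i < N" "a < bs i" for i a
  proof -
    have k: "sum bs {1..<i} + a < n" using i by (rule block_index_less)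
    have "0 = (A *\<^sub>v v) $ (sum bs {1..<i} + a)" using v(3) k by simp
    also have "\<dots> = (\<Sum>c<n. A $$ (sum bs {1..<i} + a, c) * v $ c)"
      using A_carrier k v(1) by (simp add: scalar_prod_def lessThan_atLeast0)
    also have "\<dots> = (\<Sum>j=1..<N. \<Sum>l<bs j. Kb i j $$ (a,l) * w j l)"
      unfolding sum_row_blocks using i by (intro sum.cong refl) (simp add: A_index w_def del: One_nat_def)
    also have "\<dots> = (\<Sum>j=0..<N. \<Sum>l<bs j. Kb i j $$ (a,l) * w j l)"
      by (simp add: sum_from_0 w_def)
    finally show ?thesis by simp
  qed
  have w0: "w j l = 0" if "j < N" "l < bs j" for j l
    by (rule K_kernel_zero[OF id _ K]) (use that g_nonzero in \<open>auto simp: w_def\<close>)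
  have "v = 0\<^sub>v n"
  proof (rule eq_vecI)
    fix k assume "k < dim_vec (0\<^sub>v n :: 'a poly vec)"
    then have "k < n" by simp
    then obtain j l where "1 \<le> j" "j < N" "l < bs j" "k = sum bs {1..<j} + l"
      by (rule block_index_cases)
    then show "v $ k = 0\<^sub>v n $ k" using w0[of j l] \<open>k < n\<close> by (simp add: w_def)
  qed (use v in simp)
  then show False using v(2) by simp
qed

lemma system_matrix_pencil: "system_matrix n m m S D_part C_part B_part A"
  unfolding system_matrix_def using A_carrier det_A_nonzero pencil_eq
  by (simp add: D_part_def C_part_def B_part_def)

section \<open>Minimality at every point of the field\<close>

lemma minimal_pencil:
  assumes R: "\<And>z. z \<in> finite_poles \<xi> (N - 1) \<Longrightarrow> mat_rank (ratfun_mat_eval R z) = m + r"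
  shows "minimal_at C_part B_part A x"
proof -
  define Ax where "Ax = poly_mat_eval A x"
  define Bx where "Bx = poly_mat_eval B_part x"
  define Cx where "Cx = poly_mat_eval C_part x"
  have Ax: "Ax \<in> carrier_mat n n" and Bx: "Bx \<in> carrier_mat n m" and Cx: "Cx \<in> carrier_mat m n"
    using A_carrier by (simp_all add: Ax_def Bx_def Cx_def poly_mat_eval_def B_part_def C_part_def)
  have Ax_index: "Ax $$ (i,j) = poly (A $$ (i,j)) x" if "i < n" "j < n" for i j
    using A_carrier that by (simp add: Ax_def poly_mat_eval_def)
  have Bx_index: "Bx $$ (i,j) = poly (K $$ (i,j)) x" if "i < n" "j < m" for i j
    using that by (simp add: Bx_def B_part_def poly_mat_eval_def)
  have Cx_index: "Cx $$ (i,j) = - poly (M $$ (i, j + m)) x" if "i < m" "j < n" for i j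
    using that by (simp add: Cx_def C_part_def poly_mat_eval_def)
  \<comment> \<open>A kernel vector \<open>v\<close> of the columns of \<open>A\<close> and
    \<open>C\<close>, extended by a zero block \<open>w 0\<close>, is annihilated by both
    \<open>K\<close> and \<open>M\<close>; the sign of \<open>C\<close> does not affect
    this.\<close>
  have "mat_rank (Ax @\<^sub>r Cx) = n"
    unfolding mat_rank_eq_dim_col_iff[OF carrier_append_rows[OF Ax Cx]]
  proof (intro ballI impI)
    fix v assume v: "v \<in> carrier_vec n" "(Ax @\<^sub>r Cx) *\<^sub>v v = 0\<^sub>v (n + m)"
    define w where "w j l = (if j = 0 then 0 else v $ (sum bs {1..<j} + l))" for j l
    have row: "(\<Sum>c<n. (Ax @\<^sub>r Cx) $$ (i,c) * v $ c) = 0" if "i < n + m" for i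
    proof -
      have "0 = ((Ax @\<^sub>r Cx) *\<^sub>v v) $ i" using v(2) that by simp
      also have "\<dots> = (\<Sum>c<n. (Ax @\<^sub>r Cx) $$ (i,c) * v $ c)"
        using carrier_append_rows[OF Ax Cx] that v(1)
        by (simp add: scalar_prod_def lessThan_atLeast0)
      finally show ?thesis by simp
    qed
    have K: "(\<Sum>j=0..<N. \<Sum>l<bs j. poly (Kb i j $$ (a,l)) x * w j l) = 0"
      if i: "1 \<le> i" "i < N" "a < bs i" for i a
    proof -
      have k: "sum bs {1..<i} + a < n" using i by (rule block_index_less)
      have "(\<Sum>c<n. (Ax @\<^sub>r Cx) $$ (sum bs {1..<i} + a, c) * v $ c) =
          (\<Sum>c<n. poly (A $$ (sum bs {1..<i} + a, c)) x * v $ c)"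
        using k append_rows_index[OF Ax Cx] by (intro sum.cong) (simp_all add: Ax_index)
      also have "\<dots> = (\<Sum>j=1..<N. \<Sum>l<bs j. poly (Kb i j $$ (a,l)) x * w j l)"
        unfolding sum_row_blocks using i by (intro sum.cong refl) (simp add: A_index w_def del: One_nat_def)
      also have "\<dots> = (\<Sum>j=0..<N. \<Sum>l<bs j. poly (Kb i j $$ (a,l)) x * w j l)"
        by (simp add: sum_from_0 w_def)
      finally show ?thesis using row k by simp
    qed
    have M: "(\<Sum>j=0..<N. \<Sum>l<bs j. poly (Mb j $$ (a,l)) x * w j l) = 0" if a: "a < m" for a
    proof -
      have "(\<Sum>c<n. (Ax @\<^sub>r Cx) $$ (n + a, c) * v $ c) =
          (\<Sum>c<n. - (poly (M $$ (a, c + m)) x * v $ c))"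
        using a append_rows_index[OF Ax Cx] by (intro sum.cong) (simp_all add: Cx_index)
      also have "\<dots> = (\<Sum>j=1..<N. \<Sum>l<bs j. - (poly (Mb j $$ (a,l)) x * w j l))"
        unfolding sum_row_blocks
      proof (intro sum.cong refl)
        fix j l assume j: "j \<in> {1..<N}" "l \<in> {..<bs j}"
        then have eq: "sum bs {1..<j} + l + m = sum bs {0..<j} + l" using sum_bs_from_0[of j] by simp
        show "- (poly (M $$ (a, sum bs {1..<j} + l + m)) x * v $ (sum bs {1..<j} + l)) =
            - (poly (Mb j $$ (a,l)) x * w j l)"
          unfolding eq using M_index[OF a, of j l] j by (simp add: w_def)
      qed
      also have "\<dots> = - (\<Sum>j=0..<N. \<Sum>l<bs j. poly (Mb j $$ (a,l)) x * w j l)"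
        by (simp add: sum_from_0 w_def sum_negf)
      finally show ?thesis using row[of "n + a"] a by simp
    qed
    have w0: "w j l = 0" if "j < N" "l < bs j" for j l
      by (rule right_kernel_zero[OF R K M _ that]) (auto simp: w_def)
    show "v = 0\<^sub>v n"
    proof (rule eq_vecI)
      fix k assume "k < dim_vec (0\<^sub>v n :: 'a vec)"
      then have "k < n" by simp
      then obtain j l where "1 \<le> j" "j < N" "l < bs j" "k = sum bs {1..<j} + l"
        by (rule block_index_cases)
      then show "v $ k = 0\<^sub>v n $ k" using w0[of j l] \<open>k < n\<close> by (simp add: w_def)
    qed (use v in simp)
  qed
  \<comment> \<open>Up to the order of the columns, \<open>A\<close> next to \<open>B\<close> is the
    value of \<open>K\<close> at \<open>x\<close>, so independence of the rows is the statement
    about the left kernel of \<open>K\<close>.\<close>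
  moreover have "mat_rank (Ax @\<^sub>c Bx) = n"
  proof (rule mat_rank_eq_dim_row[OF append_cols_carrier[OF Ax Bx]])
    fix y assume y: "y \<in> carrier_vec n" "\<And>j. j < n + m \<Longrightarrow> col (Ax @\<^sub>c Bx) j \<bullet> y = 0"
    have col: "(\<Sum>k<n. (Ax @\<^sub>c Bx) $$ (k,j) * y $ k) = 0" if "j < n + m" for j
      using y that append_cols_carrier[OF Ax Bx] y(2)[of j]
      by (simp add: scalar_prod_def lessThan_atLeast0)
    define y' where "y' i a = y $ (sum bs {1..<i} + a)" for i a
    have K: "(\<Sum>i=1..<N. \<Sum>a<bs i. poly (Kb i j $$ (a,l)) x * y' i a) = 0"
      if j: "j < N" "l < bs j" for j l
    proof -
      \<comment> \<open>Block column 0 of \<open>K\<close> stands behind \<open>A\<close>, hence at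
        offset \<open>n\<close>; the other block columns keep their offsets within
        \<open>A\<close>.\<close>
      define c where "c = (if j = 0 then n + l else sum bs {1..<j} + l)"
      have l: "l < m" if "j = 0" using j that by (simp add: block_size_def)
      have jn: "sum bs {1..<j} + l < n" if "j \<noteq> 0" using j that by (intro block_index_less) auto
      have c: "c < n + m" using l jn by (auto simp: c_def)
      have "(Ax @\<^sub>c Bx) $$ (k,c) = poly (K $$ (k, sum bs {0..<j} + l)) x" if k: "k < n" for k
      proof (cases "j = 0")
        case True
        then show ?thesis using append_cols_index[OF Ax Bx k c] l k by (simp add: c_def Bx_index)
      next
        case False
        then have eq: "sum bs {1..<j} + l + m = sum bs {0..<j} + l" using sum_bs_from_0[of j] by simp
        show ?thesis unfolding eq[symmetric]
          using append_cols_index[OF Ax Bx k c] jn k False by (simp add: c_def Ax_index A_eq_K)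
      qed
      then have "(\<Sum>k<n. (Ax @\<^sub>c Bx) $$ (k,c) * y $ k) =
          (\<Sum>k<n. poly (K $$ (k, sum bs {0..<j} + l)) x * y $ k)" by simp
      also have "\<dots> = (\<Sum>i=1..<N. \<Sum>a<bs i. poly (Kb i j $$ (a,l)) x * y' i a)"
        unfolding sum_row_blocks using j
        by (intro sum.cong refl) (simp add: K_index y'_def del: One_nat_def)
      finally show ?thesis using col[OF c] by simp
    qed
    show "y = 0\<^sub>v n"
    proof (rule eq_vecI)
      fix k assume "k < dim_vec (0\<^sub>v n :: 'a vec)"
      then have "k < n" by simp
      then obtain i a where i: "1 \<le> i" "i < N" "a < bs i" "k = sum bs {1..<i} + a"
        by (rule block_index_cases)
      then show "y $ k = 0\<^sub>v n $ k"
        using K_left_kernel_zero[OF K i(1-3)] \<open>k < n\<close> by (simp add: y'_def)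
    qed (use y in simp)
  qed
  ultimately show ?thesis
    using A_carrier by (simp add: minimal_at_def Ax_def Bx_def Cx_def)
qed

section \<open>The transfer function as a scalar multiple of \<open>Q\<close>\<close>

lemma b_fun_Suc: "b (Suc i) = b i * (to_fract (h i) / to_fract (g (Suc i)))"
  by (simp add: b_fun_def)

lemma b_fun_0: "const_ratfun (\<beta> 0) * b 0 = 1"
  using \<beta>_nonzero[of 0]
  by (simp add: b_fun_def const_ratfun_def flip: to_fract_mult one_pCons)

text \<open>The recurrence of the rows of \<open>K\<close> is that of \<open>b\<close>, and the
  factor \<open>\<beta> 0\<close> normalizes \<open>b 0\<close> to 1. The solution starts with the
  unit vector of index \<open>c\<close>; crossing row \<open>p + 1\<close> applies the transpose of
  \<open>U\<close> and replaces it by row \<open>c\<close> of \<open>U\<close>.\<close>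

lemma K_solution:
  fixes w :: "nat \<Rightarrow> nat \<Rightarrow> 'a ratfun"
  assumes K: "\<And>i a. 1 \<le> i \<Longrightarrow> i < N \<Longrightarrow> a < bs i \<Longrightarrow>
      (\<Sum>j=0..<N. \<Sum>l<bs j. to_fract (Kb i j $$ (a,l)) * w j l) = 0"
    and w0: "\<And>l. l < m \<Longrightarrow> w 0 l = (if l = c then 1 else 0)"
    and c: "c < m" and "j < N" "l < bs j"
  shows "w j l = const_ratfun (\<beta> 0) * b j *
    (if j \<le> p then if l = c then 1 else 0 else const_ratfun (U $$ (c,l)))"
  using assms(4,5)
proof (induction j arbitrary: l)
  case 0
  then show ?case using w0[of l] b_fun_0 by (simp add: block_size_def)
next
  case (Suc j)
  interpret to_fract: inj_comm_ring_hom "to_fract :: 'a poly \<Rightarrow> 'a ratfun"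
    by (rule inj_comm_ring_hom_to_fract)
  have g0: "to_fract (g (Suc j)) \<noteq> 0" using g_nonzero[of "Suc j"] Suc.prems by simp
  let ?e = "\<lambda>j l. if j \<le> p then if l = c then 1 else 0 else const_ratfun (U $$ (c,l))"
  note row = K[of "Suc j" l] sum_K_row[OF to_fract.comm_ring_hom_axioms, of "Suc j" l w]
  have "to_fract (g (Suc j)) * w (Suc j) l =
      to_fract (h j) * (const_ratfun (\<beta> 0) * b j) * ?e (Suc j) l"
  proof (cases "j = p")
    case True
    have "(\<Sum>a<m. to_fract [:U $$ (a,l):] * w p a) =
        (\<Sum>a<m. const_ratfun (\<beta> 0) * b p * const_ratfun (U $$ (a,l)) * (if a = c then 1 else 0))"
      using Suc.IH Suc.prems True
      by (intro sum.cong) (simp_all add: block_size_def const_ratfun_def)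
    also have "\<dots> = const_ratfun (\<beta> 0) * b p * const_ratfun (U $$ (c,l))"
      by (rule sum_mult_if_eq[OF c])
    finally show ?thesis using row Suc.prems True by (simp add: mult.assoc)
  next
    case False
    then have "l < bs j" "?e (Suc j) l = ?e j l"
      using Suc.prems by (auto simp: block_size_def split: if_splits)
    then show ?thesis using row Suc.prems Suc.IH[of l] False by (simp add: mult.assoc)
  qed
  then show ?case unfolding b_fun_Suc using g0 by (simp add: field_simps)
qed

text \<open>Let \<open>Y\<close> solve \<open>A Y = B\<close>. Since \<open>K\<close> consists of
  \<open>B\<close> and \<open>A\<close>, it annihilates the block column of \<open>I\<close> and
  \<open>- Y\<close>; applying \<open>M\<close>, which consists of \<open>D\<close> and
  \<open>- C\<close>, gives the Schur complement \<open>D + C Y\<close>. The blocks of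
  \<open>- Y\<close> are known from \<open>K_solution\<close>.\<close>

lemma transfer_function_pencil:
  "transfer_function D_part C_part B_part A =
    to_fract (Polynomial.smult (\<beta> 0 / \<beta> N) (g N)) \<cdot>\<^sub>m Q"
proof -
  interpret to_fract: inj_comm_ring_hom "to_fract :: 'a poly \<Rightarrow> 'a ratfun"
    by (rule inj_comm_ring_hom_to_fract)
  define A' where "A' = map_mat to_fract A"
  define B' where "B' = map_mat to_fract B_part"
  define C' where "C' = map_mat to_fract C_part"
  define D' where "D' = map_mat to_fract D_part"
  have A': "A' \<in> carrier_mat n n" and B': "B' \<in> carrier_mat n m"
    and C': "C' \<in> carrier_mat m n" and D': "D' \<in> carrier_mat m m"
    using A_carrier by (simp_all add: A'_def B'_def C'_def D'_def B_part_def C_part_def D_part_def)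
  have "det A' \<noteq> 0" using det_A_nonzero unfolding A'_def to_fract.hom_det by simp
  then have "A' \<in> Units (ring_mat TYPE('a ratfun) n ())" by (rule det_non_zero_imp_unit[OF A'])
  then obtain I where I: "mat_inverse A' = Some I"
    using mat_inverse(1)[OF A', where b = "()"] by (cases "mat_inverse A'") auto
  then have I': "A' * I = 1\<^sub>m n" "I \<in> carrier_mat n n" using mat_inverse(2)[OF A'] by simp_all
  define Y where "Y = I * B'"
  have Y: "Y \<in> carrier_mat n m" using I' B' by (simp add: Y_def)
  have "A' * Y = A' * I * B'" unfolding Y_def using A' I'(2) B' by simp
  then have AY: "A' * Y = B'" using I'(1) B' by simp
  have T: "transfer_function D_part C_part B_part A = D' + C' * Y"
    unfolding transfer_function_def A'_def[symmetric] B'_def[symmetric] C'_def[symmetric]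
      D'_def[symmetric] I Y_def using C' I'(2) B' by simp
  have "(D' + C' * Y) $$ (a,c) = to_fract (Polynomial.smult (\<beta> 0 / \<beta> N) (g N)) * Q $$ (a,c)"
    if ac: "a < m" "c < m" for a c
  proof -
    \<comment> \<open>Column \<open>c\<close> of the identity on top of \<open>- Y\<close>, arranged
      in blocks.\<close>
    define w where "w j l = (if j = 0 then if l = c then 1 else 0 else - Y $$ (sum bs {1..<j} + l, c))"
      for j l
    have K: "(\<Sum>j=0..<N. \<Sum>l<bs j. to_fract (Kb i j $$ (e,l)) * w j l) = 0"
      if i: "1 \<le> i" "i < N" "e < bs i" for i e
    proof -
      have k: "sum bs {1..<i} + e < n" using i by (rule block_index_less)
      have "(A' * Y) $$ (sum bs {1..<i} + e, c) =
          (\<Sum>q<n. to_fract (A $$ (sum bs {1..<i} + e, q)) * Y $$ (q,c))"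
        using A_carrier Y k ac by (simp add: A'_def scalar_prod_def lessThan_atLeast0)
      also have "\<dots> = (\<Sum>j=1..<N. \<Sum>l<bs j. - (to_fract (Kb i j $$ (e,l)) * w j l))"
        unfolding sum_row_blocks using i by (intro sum.cong refl) (simp add: A_index w_def del: One_nat_def)
      finally have "B' $$ (sum bs {1..<i} + e, c) =
          - (\<Sum>j=1..<N. \<Sum>l<bs j. to_fract (Kb i j $$ (e,l)) * w j l)"
        unfolding AY by (simp add: sum_negf)
      moreover have "B' $$ (sum bs {1..<i} + e, c) = to_fract (Kb i 0 $$ (e,c))"
        using K_index[OF i, of 0 c] k ac N_ge by (simp add: B'_def B_part_def block_size_def)
      ultimately have "to_fract (Kb i 0 $$ (e,c)) =
          - (\<Sum>j=1..<N. \<Sum>l<bs j. to_fract (Kb i j $$ (e,l)) * w j l)"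
        by (simp only:)
      moreover have "(\<Sum>l<m. to_fract (Kb i 0 $$ (e,l)) * w 0 l) = to_fract (Kb i 0 $$ (e,c))"
        unfolding w_def using sum_mult_if_eq[OF ac(2)] by simp
      ultimately show ?thesis unfolding sum_from_0 by (simp only: ab_left_minus)
    qed
    have w0: "w 0 l = (if l = c then 1 else 0)" for l by (simp add: w_def)
    note w = K_solution[OF K w0 ac(2)]
    have w_upper: "w j l = const_ratfun (\<beta> 0) * b j * (if l = c then 1 else 0)"
      if "j \<le> p" "l < m" for j l
      using w[of j l] that N_ge by (simp add: block_size_def)
    have w_lower: "w j l = const_ratfun (\<beta> 0) * b j * const_ratfun (U $$ (c,l))"
      if "p < j" "j < N" "l < r" for j l
      using w[of j l] that N_ge by (simp add: block_size_def)
    have D_sum: "(\<Sum>l<m. to_fract [:D j $$ (a,l):] * w j l) =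
        const_ratfun (\<beta> 0) * (b j * const_ratfun (D j $$ (a,c)))" if "j \<le> p" for j
    proof -
      have "(\<Sum>l<m. to_fract [:D j $$ (a,l):] * w j l) =
          (\<Sum>l<m. const_ratfun (\<beta> 0) * (b j * const_ratfun (D j $$ (a,l))) * (if l = c then 1 else 0))"
        using that by (intro sum.cong) (simp_all add: w_upper const_ratfun_def)
      then show ?thesis using sum_mult_if_eq[OF ac(2)] by simp
    qed
    interpret const: comm_ring_hom "const_ratfun :: 'a \<Rightarrow> 'a ratfun"
      by (rule comm_ring_hom_const_ratfun)
    have L_sum: "(\<Sum>l<r. to_fract [:L i $$ (a,l):] * w j l) =
        const_ratfun (\<beta> 0) * (b j * const_ratfun ((L i * U\<^sup>T) $$ (a,c)))"
      if "p < j" "j < N" "p < i" "i \<le> N" for i j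
    proof -
      have "(L i * U\<^sup>T) $$ (a,c) = (\<Sum>l<r. L i $$ (a,l) * U $$ (c,l))"
        using L_carrier[of i] U_carrier that ac by (simp add: scalar_prod_def lessThan_atLeast0)
      then show ?thesis
        using that by (simp add: w_lower const.hom_sum const.hom_mult sum_distrib_left
            flip: const_ratfun_def) (intro sum.cong; simp)
    qed
    have "(D' + C' * Y) $$ (a,c) = D' $$ (a,c) + (C' * Y) $$ (a,c)" using ac C' Y by simp
    also have "(C' * Y) $$ (a,c) = (\<Sum>k<n. to_fract (- M $$ (a, k + m)) * Y $$ (k,c))"
      using C' Y ac by (simp add: C'_def C_part_def scalar_prod_def lessThan_atLeast0)
    also have "\<dots> = (\<Sum>j=1..<N. \<Sum>l<bs j. to_fract (Mb j $$ (a,l)) * w j l)"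
      unfolding sum_row_blocks
    proof (intro sum.cong refl)
      fix j l assume j: "j \<in> {1..<N}" "l \<in> {..<bs j}"
      then have eq: "sum bs {1..<j} + l + m = sum bs {0..<j} + l" using sum_bs_from_0[of j] by simp
      show "to_fract (- M $$ (a, sum bs {1..<j} + l + m)) * Y $$ (sum bs {1..<j} + l, c) =
          to_fract (Mb j $$ (a,l)) * w j l"
        unfolding eq using M_index[OF ac(1), of j l] j by (simp add: w_def)
    qed
    also have "D' $$ (a,c) = (\<Sum>l<m. to_fract (Mb 0 $$ (a,l)) * w 0 l)"
      unfolding w0 sum_mult_if_eq[OF ac(2)] using M_index[OF ac(1), of 0 c] ac N_ge
      by (simp add: D'_def D_part_def block_size_def)
    also have "(\<Sum>l<m. to_fract (Mb 0 $$ (a,l)) * w 0 l) +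
        (\<Sum>j=1..<N. \<Sum>l<bs j. to_fract (Mb j $$ (a,l)) * w j l) =
        (\<Sum>j=0..<N. \<Sum>l<bs j. to_fract (Mb j $$ (a,l)) * w j l)"
      by (rule sum_from_0[symmetric])
    also have "\<dots> = to_fract gN * ((\<Sum>j=0..p. \<Sum>l<m. to_fract [:D j $$ (a,l):] * w j l) +
          (\<Sum>j=p+1..N-1. \<Sum>l<r. to_fract [:L j $$ (a,l):] * w j l)) +
        to_fract hN * (\<Sum>l<r. to_fract [:L N $$ (a,l):] * w (N - 1) l)"
      by (rule sum_M_row[OF to_fract.comm_ring_hom_axioms ac(1)])
    also have "(\<Sum>j=0..p. \<Sum>l<m. to_fract [:D j $$ (a,l):] * w j l) =
        const_ratfun (\<beta> 0) * (\<Sum>j=0..p. b j * const_ratfun (D j $$ (a,c)))"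
      by (simp add: D_sum sum_distrib_left)
    also have "(\<Sum>j=p+1..N-1. \<Sum>l<r. to_fract [:L j $$ (a,l):] * w j l) =
        const_ratfun (\<beta> 0) * (\<Sum>j=p+1..N-1. b j * const_ratfun ((L j * U\<^sup>T) $$ (a,c)))"
      unfolding sum_distrib_left using N_ge by (intro sum.cong refl L_sum) auto
    also have "(\<Sum>l<r. to_fract [:L N $$ (a,l):] * w (N - 1) l) =
        const_ratfun (\<beta> 0) * (b (N - 1) * const_ratfun ((L N * U\<^sup>T) $$ (a,c)))"
      using N_ge by (intro L_sum) auto
    finally have entry: "(D' + C' * Y) $$ (a,c) =
      to_fract gN * (const_ratfun (\<beta> 0) * (\<Sum>j=0..p. b j * const_ratfun (D j $$ (a,c))) +
        const_ratfun (\<beta> 0) * (\<Sum>j=p+1..N-1. b j * const_ratfun ((L j * U\<^sup>T) $$ (a,c)))) +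
      to_fract hN * (const_ratfun (\<beta> 0) * (b (N - 1) * const_ratfun ((L N * U\<^sup>T) $$ (a,c))))" .
    have smult: "to_fract (Polynomial.smult c f) = const_ratfun c * to_fract f" for c and f :: "'a poly"
      by (simp add: const_ratfun_def flip: to_fract_mult)
    have "N = Suc (N - 1)" using N_ge by simp
    then have "b N = b (N - 1) * (to_fract (h (N - 1)) / to_fract (g N))"
      using b_fun_Suc[of "N - 1"] by simp
    \<comment> \<open>The last factor of \<open>b N\<close> is \<open>h (N - 1) / g N\<close>. The
      term with \<open>hN\<close> therefore turns into the summand of \<open>Q\<close> with index
      \<open>N\<close>, carrying the same factor \<open>gN\<close> as all others.\<close>
    then have bN: "to_fract hN * b (N - 1) = to_fract gN * b N"
      using g_nonzero[of N] N_ge by (simp add: smult)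
    have "{p+1..N} = insert N {p+1..N-1}" "N \<notin> {p+1..N-1}" using N_ge by auto
    then have Q: "Q $$ (a,c) = (\<Sum>j=0..p. b j * const_ratfun (D j $$ (a,c))) +
        ((\<Sum>j=p+1..N-1. b j * const_ratfun ((L j * U\<^sup>T) $$ (a,c))) +
         b N * const_ratfun ((L N * U\<^sup>T) $$ (a,c)))"
      using ac by (simp add: Q_mat_def add.commute)
    have c: "to_fract (Polynomial.smult (\<beta> 0 / \<beta> N) (g N)) = const_ratfun (\<beta> 0) * to_fract gN"
      by (simp add: const_ratfun_def flip: to_fract_mult)
    have hb: "to_fract hN * (const_ratfun (\<beta> 0) * (b (N - 1) * t)) =
        const_ratfun (\<beta> 0) * to_fract gN * (b N * t)" for t
      using bN by (metis (no_types) mult.assoc mult.left_commute)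
    show ?thesis unfolding entry Q c hb by (simp only: distrib_left mult.assoc mult.left_commute add.assoc)
  qed
  then show ?thesis unfolding T using C' Y D' by (intro eq_matI) (simp_all add: Q_mat_def)
qed

section \<open>Regular multipliers and the linearization\<close>

lemma regular_at_scalar:
  assumes "poly f x \<noteq> 0"
  shows "regular_at (to_fract f \<cdot>\<^sub>m 1\<^sub>m k) x"
proof -
  have pow: "to_fract f ^ k = to_fract (f ^ k)" by (induction k) simp_all
  have "det (to_fract f \<cdot>\<^sub>m 1\<^sub>m k) = to_fract (f ^ k)" by (simp add: det_smult pow)
  then have "ratfun_eval (det (to_fract f \<cdot>\<^sub>m 1\<^sub>m k)) x \<noteq> 0"
    using assms by (simp add: ratfun_to_fract del: det_smult)
  moreover have "ratfun_defined_at ((to_fract f \<cdot>\<^sub>m 1\<^sub>m k) $$ (i,j)) x" if "i < k" "j < k" for i j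
    using that ratfun_to_fract[of f x] ratfun_to_fract[of 0 x] by simp
  ultimately show ?thesis by (simp add: regular_at_def)
qed

text \<open>Only \<xi> \<open>N\<close> has to be avoided: minimality holds at every point, and the
  scalar relating the transfer function to \<open>Q\<close> is a nonzero multiple of
  \<open>g N\<close>.\<close>

lemma pencil_linearization:
  assumes R: "\<And>z. z \<in> finite_poles \<xi> (N - 1) \<Longrightarrow> mat_rank (ratfun_mat_eval R z) = m + r"
    and \<Sigma>: "\<Sigma> \<noteq> {}" "\<And>x. x \<in> \<Sigma> \<Longrightarrow> \<xi> N \<noteq> Some x"
  shows "linearization S Q A \<Sigma>"
proof -
  let ?f = "Polynomial.smult (\<beta> 0 / \<beta> N) (g N)"
  have Q: "Q \<in> carrier_mat m m" by (simp add: Q_mat_def)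
  have eq: "(to_fract ?f \<cdot>\<^sub>m 1\<^sub>m m) * Q * 1\<^sub>m m = transfer_function D_part C_part B_part A"
    unfolding transfer_function_pencil
    using Q mult_smult_assoc_mat[of "1\<^sub>m m" m m Q m] by simp
  have f: "poly ?f x \<noteq> 0" if "x \<in> \<Sigma>" for x
    using \<Sigma>(2)[OF that] poly_g_eq_0_iff[of N x] \<beta>_nonzero[of 0] \<beta>_nonzero[of N] N_ge by simp
  have "to_fract 1 \<cdot>\<^sub>m 1\<^sub>m m = (1\<^sub>m m :: 'a ratfun mat)" by (rule eq_matI) simp_all
  then have one: "regular_at (1\<^sub>m m) x" for x :: 'a using regular_at_scalar[of 1 x m] by simp
  have "\<exists>s1 s2 R1 R2. int s1 - int s2 = int m - int m \<and> int s1 - int s2 = int m - int m \<and>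
      R1 \<in> carrier_mat (m + s1) (m + s1) \<and> R2 \<in> carrier_mat (m + s1) (m + s1) \<and>
      regular_at R1 x \<and> regular_at R2 x \<and>
      R1 * diag_id Q s1 * R2 = diag_id (transfer_function D_part C_part B_part A) s2"
    if x: "x \<in> \<Sigma>" for x
    \<comment> \<open>No identity blocks are added, the left multiplier is the scalar matrix of
      \<open>?f\<close>, and the right one is the identity.\<close>
    by (rule exI[of _ 0], rule exI[of _ 0], rule exI[of _ "to_fract ?f \<cdot>\<^sub>m 1\<^sub>m m"],
        rule exI[of _ "1\<^sub>m m"])
      (use regular_at_scalar[OF f[OF x], of m] one eq
        in \<open>simp add: diag_id_0\<close>)
  then show ?thesis
    unfolding linearization_def
    using \<Sigma>(1) linear_pencil Q system_matrix_pencil minimal_pencil[OF R] by blast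
qed

end

theorem theorem6p9:
  fixes m r p N :: nat
    and \<sigma> \<beta> :: "nat \<Rightarrow> 'a::alg_closed_field"
    and \<xi> :: "nat \<Rightarrow> 'a option"
    and D L :: "nat \<Rightarrow> 'a mat"
    and U :: "'a mat"
  assumes "m \<ge> 1" and "r \<ge> 1" and "1 \<le> p" and "p + 2 \<le> N"
    and "\<And>i. i \<in> {1..N} \<Longrightarrow> \<xi> i \<noteq> Some 0"
    and "\<And>i. i \<in> {0..N} \<Longrightarrow> \<beta> i \<noteq> 0"
    and "\<And>i. i \<in> {0..p} \<Longrightarrow> D i \<in> carrier_mat m m"
    and "\<And>i. i \<in> {p+1..N} \<Longrightarrow> L i \<in> carrier_mat m r"
    and "U \<in> carrier_mat m r"
    and "mat_rank U = r"
    and "\<And>i j. i \<in> {1..N} \<Longrightarrow> j \<in> {0..N-1} \<Longrightarrow> \<xi> i \<noteq> Some (\<sigma> j)"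
    and "\<And>z. z \<in> finite_poles \<xi> (N - 1) \<Longrightarrow>
           mat_rank (ratfun_mat_eval (R_mat m r p N \<sigma> \<beta> \<xi> D L U) z) = m + r"
  shows "linearization (L_pencil m r p N \<sigma> \<beta> \<xi> D L U) (Q_mat m p N \<sigma> \<beta> \<xi> D L U)
           (A_mat m r p N \<sigma> \<beta> \<xi> U)
           (case \<xi> N of None \<Rightarrow> UNIV | Some z \<Rightarrow> UNIV - {z})"
proof -
  interpret low_rank_pencil m r p N \<sigma> \<beta> \<xi> D L U
    using assms(3-11) by unfold_locales auto
  show ?thesis
  proof (cases "\<xi> N")
    case None
    then show ?thesis using pencil_linearization[OF assms(12), of UNIV] by simp
  next
    case (Some z)
    \<comment> \<open>Since 1 is nonzero, this element witnesses that the field without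
      \<open>z\<close> is nonempty, as the definition of a linearization demands.\<close>
    have "z + 1 \<in> UNIV - {z}" by simp
    then have "UNIV - {z} \<noteq> {}" by blast
    then show ?thesis using pencil_linearization[OF assms(12), of "UNIV - {z}"] Some by simp
  qed
qed

end
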